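(* The map $J$ that associates to a deterministic flow of partitions $\hat\pi$ the collection of its jumps $J(\hat\pi)=\{(s,v_s):\hat\pi_{s-,s}\ne O_{[\infty]}\}$ is a bijection between the set of deterministic flows of partitions and the set of deterministic lookdown graphs.
   Context: **Partitions.** $\mathcal P_\infty$ is the set of partitions of $\mathbb N=\{1,2,\ldots\}$; $\pi^{[n]}$ is the restriction of $\pi$ to $[n]=\{1,\ldots,n\}$; $O_{[\infty]}$ is the partition of $\mathbb N$ into singletons. Limits are for the distance $d(\pi,\pi')=2^{-\sup\{n\ge1:\pi^{[n]}=\pi'^{[n]}\}}$. Blocks are ordered by least element, $\pi(i)$ is the $i$-th block ($\emptyset$ if there are fewer than $i$ blocks). $\mathrm{Coag}(\pi,\pi')$ is the partition whose $i$-th block is $\bigcup_{j\in\pi'(i)}\pi(j)$. **Deterministic flow of partitions.** A collection $\hat\pi=(\hat\pi_{s,t},-\infty<s\le t<\infty)$ of partitions of $\mathbb N$ such that: for all $r<s<t$, $\hat\pi_{r,t}=\mathrm{Coag}(\hat\pi_{s,t},\hat\pi_{r,s})$; for all $s$, $\hat\pi_{s,s}=O_{[\infty]}$ and $\hat\pi_{s-,s}:=\lim_{r\uparrow s}\hat\pi_{r,s}$ exists and is either a partition with a unique non-singleton block or $O_{[\infty]}$; for all $t$, $\lim_{r<s<t,\ r,s\uparrow t}\hat\pi_{r,s}$ exists and equals $O_{[\infty]}$; for all $s$, $\lim_{t\downarrow s}\hat\pi_{s,t}$ exists and equals $O_{[\infty]}$. **Deterministic lookdown graph.** $\mathcal S_\infty$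 is the set of $v\in\{0,1\}^{\mathbb N}$ with at least two coordinates equal to $1$; for $n\ge2$, $\mathcal S_n$ is the set of $v\in\{0,1\}^{\mathbb N}$ with at least two coordinates equal to $1$ among the first $n$. A deterministic lookdown graph is a countable subset $\mathtt p$ of $\mathbb R\times\mathcal S_\infty$ such that for all $n$ and all $s\le t$, the set $\mathtt p\cap([s,t]\times\mathcal S_n)$ has a finite number of points. **Jumps.** When $\hat\pi_{s-,s}\neq O_{[\infty]}$, $v_s\in\mathcal S_\infty$ is the element whose $i$-th coordinate is $1$ if and only if $i$ belongs to the non-singleton block of $\hat\pi_{s-,s}$.
   Formalization: The bijection is onto the deterministic lookdown graphs with at most one point at each time; the definition also allows two points (s,v), (s,v') with the same s, and such graphs are never of the form J(π̂), so the claim fails without this condition. *)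

theory Defs
  imports "HOL-Analysis.Analysis"
begin

section \<open>Partitions of the positive integers\<close>

text \<open>The ground set is \<open>{1..}\<close>; a partition is the set of its (nonempty) blocks.\<close>

definition partitions :: "nat set set set" where
  "partitions = {\<pi>. partition_on {1..} \<pi>}"

definition singletons :: "nat set set" where
  "singletons = {{i} | i. 1 \<le> i}"

definition restrict_partition :: "nat \<Rightarrow> nat set set \<Rightarrow> nat set set" where
  "restrict_partition n \<pi> = {B \<inter> {1..n} | B. B \<in> \<pi>} - {{}}"

text \<open>The set \<open>A\<close> below is unbounded exactly when its supremum is infinite; then the distance
  \<open>2 powr (- \<infinity>)\<close> is zero.\<close>

definition partition_dist :: "nat set set \<Rightarrow> nat set set \<Rightarrow> real" where
  "partition_dist \<pi> \<rho> =
     (let A = {n. 1 \<le> n \<and> restrict_partition n \<pi> = restrict_partition n \<rho>}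
      in if bdd_above A then 2 powr (- real (Sup A)) else 0)"

abbreviation partition_topology :: "nat set set topology" where
  "partition_topology \<equiv> Metric_space.mtopology partitions partition_dist"

text \<open>\<open>block \<pi> i\<close> is the \<open>i\<close>-th block (\<open>i \<ge> 1\<close>) when the blocks are ordered by least element:
  at most one block \<open>B\<close> has exactly \<open>i\<close> blocks \<open>C\<close> with \<open>Inf C \<le> Inf B\<close>, and the union
  below is that block if it exists and \<open>{}\<close> otherwise.  On \<^typ>\<open>nat set\<close>, \<open>Inf\<close> is the least
  element.\<close>

definition block :: "nat set set \<Rightarrow> nat \<Rightarrow> nat set" where
  "block \<pi> i = \<Union>{B \<in> \<pi>. card {C \<in> \<pi>. Inf C \<le> Inf B} = i}"

text \<open>Empty unions are discarded; they occur only for indices beyond the number of blocks of the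
  result, so that the \<open>i\<close>-th block is as expected: see \<open>block_coag\<close>.\<close>

definition coag :: "nat set set \<Rightarrow> nat set set \<Rightarrow> nat set set" where
  "coag \<pi> \<rho> = {(\<Union>j\<in>block \<rho> i. block \<pi> j) | i. 1 \<le> i} - {{}}"

definition non_singleton_block :: "nat set set \<Rightarrow> nat set" where
  "non_singleton_block \<pi> = (THE B. B \<in> \<pi> \<and> \<not> is_singleton B)"


section \<open>Deterministic flows of partitions\<close>

text \<open>Flows are indexed by the pairs \<open>(s, t)\<close> with \<open>s \<le> t\<close>.  They are extensional functions, so
  that equality of flows is equality of the indexed collections.\<close>

definition flows :: "(real \<times> real \<Rightarrow> nat set set) set" where
  "flows = {\<pi> \<in> {(s, t). s \<le> t} \<rightarrow>\<^sub>E partitions.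
     (\<forall>r s t. r < s \<longrightarrow> s < t \<longrightarrow> \<pi> (r, t) = coag (\<pi> (s, t)) (\<pi> (r, s))) \<and>
     (\<forall>s. \<pi> (s, s) = singletons \<and>
       (\<exists>\<rho>. limitin partition_topology (\<lambda>r. \<pi> (r, s)) \<rho> (at_left s) \<and>
         ((\<exists>!B. B \<in> \<rho> \<and> \<not> is_singleton B) \<or> \<rho> = singletons))) \<and>
     (\<forall>t. limitin partition_topology \<pi> singletons (at (t, t) within {(r, s). r < s \<and> s < t})) \<and>
     (\<forall>s. limitin partition_topology (\<lambda>t. \<pi> (s, t)) singletons (at_right s))}"

definition left_limit :: "(real \<times> real \<Rightarrow> nat set set) \<Rightarrow> real \<Rightarrow> nat set set" where
  "left_limit \<pi> s = (THE \<rho>. limitin partition_topology (\<lambda>r. \<pi> (r, s)) \<rho> (at_left s))"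


section \<open>Deterministic lookdown graphs\<close>

definition marks :: "(nat \<Rightarrow> nat) set" where
  "marks = {v \<in> {1..} \<rightarrow>\<^sub>E {0, 1}. \<exists>i\<ge>1. \<exists>j\<ge>1. i \<noteq> j \<and> v i = 1 \<and> v j = 1}"

definition marks_upto :: "nat \<Rightarrow> (nat \<Rightarrow> nat) set" where
  "marks_upto n =
     {v \<in> {1..} \<rightarrow>\<^sub>E {0, 1}. \<exists>i\<in>{1..n}. \<exists>j\<in>{1..n}. i \<noteq> j \<and> v i = 1 \<and> v j = 1}"

definition lookdown_graphs :: "(real \<times> (nat \<Rightarrow> nat)) set set" where
  "lookdown_graphs = {p. p \<subseteq> UNIV \<times> marks \<and> countable p \<and>
     (\<forall>n\<ge>2. \<forall>s t. s \<le> t \<longrightarrow> finite (p \<inter> ({s..t} \<times> marks_upto n)))}"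

definition jump_mark :: "(real \<times> real \<Rightarrow> nat set set) \<Rightarrow> real \<Rightarrow> nat \<Rightarrow> nat" where
  "jump_mark \<pi> s = (\<lambda>i\<in>{1..}. if i \<in> non_singleton_block (left_limit \<pi> s) then 1 else 0)"

definition jumps :: "(real \<times> real \<Rightarrow> nat set set) \<Rightarrow> (real \<times> (nat \<Rightarrow> nat)) set" where
  "jumps \<pi> = {(s, jump_mark \<pi> s) | s. left_limit \<pi> s \<noteq> singletons}"


section \<open>Basic facts about the definitions\<close>

subsection \<open>The distance is a metric\<close>

lemma restrict_partition_mono:
  assumes "restrict_partition n \<pi> = restrict_partition n \<rho>" "m \<le> n"
  shows "restrict_partition m \<pi> = restrict_partition m \<rho>"
proof -
  have *: "restrict_partition m \<sigma> = (\<lambda>B. B \<inter> {1..m}) ` restrict_partition n \<sigma> - {{}}" for \<sigma>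
  proof (intro equalityI subsetI)
    fix D assume "D \<in> restrict_partition m \<sigma>"
    then obtain B where B: "B \<in> \<sigma>" "D = B \<inter> {1..m}" "D \<noteq> {}"
      unfolding restrict_partition_def by blast
    have "D = (B \<inter> {1..n}) \<inter> {1..m}" using B(2) assms(2) by auto
    moreover from this have "B \<inter> {1..n} \<in> restrict_partition n \<sigma>"
      using B unfolding restrict_partition_def by blast
    ultimately show "D \<in> (\<lambda>B. B \<inter> {1..m}) ` restrict_partition n \<sigma> - {{}}"
      using B(3) by blast
  next
    fix D assume "D \<in> (\<lambda>B. B \<inter> {1..m}) ` restrict_partition n \<sigma> - {{}}"
    then obtain B where B: "B \<in> \<sigma>" "D = (B \<inter> {1..n}) \<inter> {1..m}" "D \<noteq> {}"
      unfolding restrict_partition_def by blast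
    have "D = B \<inter> {1..m}" using B(2) assms(2) by auto
    then show "D \<in> restrict_partition m \<sigma>"
      using B(1,3) unfolding restrict_partition_def by blast
  qed
  show ?thesis using *[of \<pi>] *[of \<rho>] assms(1) by simp
qed

lemma restrict_partition_all_subset:
  assumes "\<pi> \<in> partitions" "\<rho> \<in> partitions"
    and eq: "\<And>n. restrict_partition n \<pi> = restrict_partition n \<rho>"
  shows "\<pi> \<subseteq> \<rho>"
proof
  fix B assume B: "B \<in> \<pi>"
  have P: "partition_on {1..} \<pi>" "partition_on {1..} \<rho>"
    using assms by (auto simp: partitions_def)
  obtain x where x: "x \<in> B" "x \<ge> 1"
  proof -
    have "B \<noteq> {}" using B P(1) by (auto simp: partition_on_def)
    then obtain x where "x \<in> B" by blast
    moreover from this have "x \<in> {1..}" using B partition_onD1[OF P(1)] by blast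
    ultimately show ?thesis using that by simp
  qed
  obtain C where C: "C \<in> \<rho>" "x \<in> C"
  proof -
    have "x \<in> \<Union>\<rho>" unfolding partition_onD1[OF P(2), symmetric] using x(2) by simp
    then show ?thesis using that by blast
  qed
  have *: "B \<inter> {1..n} = C \<inter> {1..n}" if "n \<ge> x" for n
  proof -
    have "B \<inter> {1..n} \<in> restrict_partition n \<pi>"
      unfolding restrict_partition_def using B x that by auto
    then have "B \<inter> {1..n} \<in> restrict_partition n \<rho>" by (simp add: eq)
    then obtain D where D: "D \<in> \<rho>" "B \<inter> {1..n} = D \<inter> {1..n}"
      unfolding restrict_partition_def by auto
    have "x \<in> B \<inter> {1..n}" using x that by simp
    then have "x \<in> D \<inter> C" using D(2) C(2) by blast
    then have "D = C" using disjointD[OF partition_onD2[OF P(2)] D(1) C(1)] by blast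
    then show ?thesis using D by simp
  qed
  have iff: "y \<in> B \<longleftrightarrow> y \<in> C" if "y \<ge> 1" for y
  proof -
    have "B \<inter> {1..max x y} = C \<inter> {1..max x y}" using * by simp
    moreover have "y \<in> {1..max x y}" using that by simp
    ultimately show ?thesis by blast
  qed
  have "B \<subseteq> {1..}" "C \<subseteq> {1..}" 
    using partition_onD1[OF P(1)] partition_onD1[OF P(2)] B C(1) by blast+
  then have "B = C" using iff by (auto simp: subset_iff)
  then show "B \<in> \<rho>" using C by simp
qed

lemma partition_dist_cases:
  fixes \<pi> \<rho> :: "nat set set"
  assumes "\<pi> \<in> partitions" "\<rho> \<in> partitions"
  obtains (eq) "\<pi> = \<rho>" "partition_dist \<pi> \<rho> = 0"
  | (neq) N where "\<pi> \<noteq> \<rho>" "partition_dist \<pi> \<rho> = 2 powr (- real N)"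
      "\<And>n. restrict_partition n \<pi> = restrict_partition n \<rho> \<longleftrightarrow> n \<le> N"
proof (cases "\<pi> = \<rho>")
  case True
  have "\<not> bdd_above {n. 1 \<le> (n::nat)}"
  proof
    assume "bdd_above {n. 1 \<le> (n::nat)}"
    then obtain M where "\<And>n. 1 \<le> n \<Longrightarrow> n \<le> (M::nat)" unfolding bdd_above_def by auto
    from this[of "Suc M"] show False by simp
  qed
  then show ?thesis using eq True by (simp add: partition_dist_def Let_def)
next
  case False
  define A where "A = {n. 1 \<le> n \<and> restrict_partition n \<pi> = restrict_partition n \<rho>}"
  obtain m where m: "restrict_partition m \<pi> \<noteq> restrict_partition m \<rho>"
    using False restrict_partition_all_subset assms by (metis subset_antisym)
  have r1: "restrict_partition 1 \<sigma> = {{1}}" if "\<sigma> \<in> partitions" for \<sigma>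
  proof -
    from that have P: "partition_on {1..} \<sigma>" by (simp add: partitions_def)
    have "1 \<in> \<Union>\<sigma>" unfolding partition_onD1[OF P, symmetric] by simp
    then obtain B where "B \<in> \<sigma>" "1 \<in> B" by blast
    then have "B \<in> \<sigma> \<and> {1} = B \<inter> {1..1}" by auto
    then have "{1} \<in> restrict_partition 1 \<sigma>" unfolding restrict_partition_def by blast
    moreover have "D \<in> {{1}}" if "D \<in> restrict_partition 1 \<sigma>" for D
      using that unfolding restrict_partition_def by auto
    ultimately show ?thesis by blast
  qed
  have A1: "1 \<in> A" using r1 assms by (simp add: A_def)
  have bnd: "n < m" if "n \<in> A" for n
  proof (rule ccontr)
    assume "\<not> n < m"
    then show False using restrict_partition_mono[of n \<pi> \<rho> m] that m by (simp add: A_def)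
  qed
  then have bdd: "bdd_above A" by (meson bdd_above.I less_imp_le)
  have "finite A" using bnd by (rule bounded_nat_set_is_finite[of A m, rule_format])
  then have "Sup A \<in> A" using A1 Max_in[of A] by (auto simp: Sup_nat_def)
  have iff: "restrict_partition n \<pi> = restrict_partition n \<rho> \<longleftrightarrow> n \<le> Sup A" for n
  proof
    assume "restrict_partition n \<pi> = restrict_partition n \<rho>"
    then have "n = 0 \<or> n \<in> A" by (auto simp: A_def)
    then show "n \<le> Sup A" using cSup_upper[OF _ bdd, of n] by auto
  next
    assume "n \<le> Sup A"
    moreover have "restrict_partition (Sup A) \<pi> = restrict_partition (Sup A) \<rho>"
      using \<open>Sup A \<in> A\<close> unfolding A_def by blast
    ultimately show "restrict_partition n \<pi> = restrict_partition n \<rho>"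
      by (rule restrict_partition_mono[rotated])
  qed
  have "partition_dist \<pi> \<rho> = 2 powr - real (Sup A)"
    using bdd unfolding partition_dist_def A_def[symmetric] by simp
  from neq[OF False this iff] show ?thesis .
qed

global_interpretation partitions: Metric_space partitions partition_dist
proof
  fix \<pi> \<rho> :: "nat set set"
  show "0 \<le> partition_dist \<pi> \<rho>" by (simp add: partition_dist_def Let_def)
  show "partition_dist \<pi> \<rho> = partition_dist \<rho> \<pi>"
    unfolding partition_dist_def by (simp add: eq_commute)
next
  fix \<pi> \<rho> assume "\<pi> \<in> partitions" "\<rho> \<in> partitions"
  then show "partition_dist \<pi> \<rho> = 0 \<longleftrightarrow> \<pi> = \<rho>"
    by (cases rule: partition_dist_cases) auto
next
  fix \<pi> \<rho> \<sigma> assume *: "\<pi> \<in> partitions" "\<rho> \<in> partitions" "\<sigma> \<in> partitions"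
  have nn: "0 \<le> partition_dist a b" for a b by (simp add: partition_dist_def Let_def)
  from *(1,3) show "partition_dist \<pi> \<sigma> \<le> partition_dist \<pi> \<rho> + partition_dist \<rho> \<sigma>"
  proof (cases rule: partition_dist_cases)
    case eq
    then show ?thesis using nn by (simp add: add_nonneg_nonneg)
  next
    case (neq N)
    note N = neq
    from *(1,2) show ?thesis
    proof (cases rule: partition_dist_cases)
      case eq
      then show ?thesis by simp
    next
      case (neq K)
      note K = neq
      from *(2,3) show ?thesis
      proof (cases rule: partition_dist_cases)
        case eq
        then show ?thesis by simp
      next
        case (neq L)
        have "min K L \<le> N" using N(3) K(3) neq(3) by (metis min.cobounded1 min.cobounded2)
        then have "K \<le> N \<or> L \<le> N" by linarith
        then have "(2::real) powr - real N \<le> 2 powr - real K \<or> (2::real) powr - real N \<le> 2 powr - real L"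
          by auto
        moreover have "0 \<le> (2::real) powr - real K" "0 \<le> (2::real) powr - real L" by auto
        ultimately show ?thesis using N(2) K(2) neq(2) by linarith
      qed
    qed
  qed
qed


subsection \<open>The blocks of a coagulation\<close>

lemma Inf_nat_in: "B \<noteq> {} \<Longrightarrow> Inf B \<in> (B :: nat set)"
  by (rule Inf_nat_def1)

lemma Inf_nat_le: "x \<in> B \<Longrightarrow> Inf B \<le> (x :: nat)"
  by (simp add: cInf_lower)

lemma inj_on_Inf_partition:
  assumes "\<pi> \<in> partitions"
  shows "inj_on Inf \<pi>"
proof (rule inj_onI)
  fix B C assume "B \<in> \<pi>" "C \<in> \<pi>" "Inf B = Inf C"
  moreover from this have "B \<noteq> {}" "C \<noteq> {}"
    using assms by (auto simp: partitions_def partition_on_def)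
  then have "Inf B \<in> B" "Inf C \<in> C" by (simp_all add: Inf_nat_in)
  moreover have "disjoint \<pi>" using assms by (simp add: partitions_def partition_on_def)
  ultimately show "B = C" unfolding disjoint_def by (metis disjoint_iff)
qed

lemma finite_Inf_le_partition:
  assumes "\<pi> \<in> partitions"
  shows "finite {C \<in> \<pi>. Inf C \<le> n}"
proof (rule inj_on_finite[of Inf _ "{..n}"])
  show "inj_on Inf {C \<in> \<pi>. Inf C \<le> n}"
    using inj_on_Inf_partition[OF assms] by (rule inj_on_subset) auto
qed auto

lemma block_cases:
  assumes "\<pi> \<in> partitions"
  obtains "block \<pi> i = {}" "\<not> (\<exists>B\<in>\<pi>. card {C \<in> \<pi>. Inf C \<le> Inf B} = i)"
  | "block \<pi> i \<in> \<pi>" "block \<pi> i \<noteq> {}" "card {C \<in> \<pi>. Inf C \<le> Inf (block \<pi> i)} = i"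
proof (cases "\<exists>B\<in>\<pi>. card {C \<in> \<pi>. Inf C \<le> Inf B} = i")
  case False
  then show ?thesis using that(1) by (auto simp: block_def)
next
  case True
  then obtain B where B: "B \<in> \<pi>" "card {C \<in> \<pi>. Inf C \<le> Inf B} = i" by auto
  note fin = finite_Inf_le_partition[OF assms]
  have less: "card {C \<in> \<pi>. Inf C \<le> Inf D} < card {C \<in> \<pi>. Inf C \<le> Inf E}"
    if "D \<in> \<pi>" "E \<in> \<pi>" "Inf D < Inf E" for D E
    by (rule psubset_card_mono[OF fin]) (use that in force)
  have "D = B" if "D \<in> \<pi>" "card {C \<in> \<pi>. Inf C \<le> Inf D} = i" for D
  proof -
    have "\<not> Inf D < Inf B" using less[of D B] that B by auto
    moreover have "\<not> Inf B < Inf D" using less[of B D] that B by auto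
    ultimately have "Inf D = Inf B" by linarith
    then show ?thesis using inj_onD[OF inj_on_Inf_partition[OF assms]] that(1) B(1) by blast
  qed
  then have "{B \<in> \<pi>. card {C \<in> \<pi>. Inf C \<le> Inf B} = i} = {B}" using B by blast
  then have "block \<pi> i = B" by (simp add: block_def)
  moreover have "B \<noteq> {}" using B assms by (auto simp: partitions_def partition_on_def)
  ultimately show ?thesis using that(2) B by simp
qed

lemma block_less:
  assumes "\<pi> \<in> partitions" "1 \<le> i" "i < j" "block \<pi> j \<noteq> {}"
  shows "block \<pi> i \<noteq> {}" "Inf (block \<pi> i) < Inf (block \<pi> j)"
proof -
  define rk where "rk B = card {C \<in> \<pi>. Inf C \<le> Inf B}" for B
  note fin = finite_Inf_le_partition[OF assms(1)]
  have less: "rk D < rk E" if "D \<in> \<pi>" "E \<in> \<pi>" "Inf D < Inf E" for D E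
    unfolding rk_def by (rule psubset_card_mono[OF fin]) (use that in force)
  have bj: "block \<pi> j \<in> \<pi>" "rk (block \<pi> j) = j"
    unfolding rk_def using assms(4) by (cases rule: block_cases[OF assms(1), of j]; simp)+
  define S where "S = {C \<in> \<pi>. Inf C \<le> Inf (block \<pi> j)}"
  have cS: "card S = j" using bj by (simp add: S_def rk_def)
  have finS: "finite S" by (simp add: S_def fin)
  have inj: "inj_on rk S"
  proof (rule inj_onI)
    fix D E assume "D \<in> S" "E \<in> S" "rk D = rk E"
    then show "D = E" using less[of D E] less[of E D] inj_on_Inf_partition[OF assms(1)]
      by (metis (no_types, lifting) S_def inj_onD mem_Collect_eq nat_neq_iff)
  qed
  have "rk ` S \<subseteq> {1..j}"
  proof
    fix k assume "k \<in> rk ` S"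
    then obtain D where D: "D \<in> S" "k = rk D" by auto
    have "{C \<in> \<pi>. Inf C \<le> Inf D} \<subseteq> S" using D by (auto simp: S_def)
    then have "k \<le> j" using D cS finS unfolding rk_def by (metis card_mono)
    moreover have "rk D > 0" unfolding rk_def card_gt_0_iff using fin D by (auto simp: S_def)
    ultimately show "k \<in> {1..j}" using D by auto
  qed
  moreover have "card (rk ` S) = card {1..j}" using inj cS by (simp add: card_image)
  ultimately have "rk ` S = {1..j}" by (intro card_subset_eq) auto
  then obtain D where D: "D \<in> S" "rk D = i" using assms(2,3) by (metis atLeastAtMost_iff imageE less_imp_le)
  then have "D \<in> \<pi>" by (simp add: S_def)
  then have bi: "block \<pi> i \<in> \<pi>" "block \<pi> i \<noteq> {}" "rk (block \<pi> i) = i"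
    unfolding rk_def using D(2)[unfolded rk_def]
    by (cases rule: block_cases[OF assms(1), of i]; blast)+
  show "block \<pi> i \<noteq> {}" by fact
  show "Inf (block \<pi> i) < Inf (block \<pi> j)"
  proof (rule ccontr)
    assume "\<not> ?thesis"
    then consider "Inf (block \<pi> j) < Inf (block \<pi> i)" | "Inf (block \<pi> i) = Inf (block \<pi> j)"
      by linarith
    then show False
    proof cases
      case 1
      then show ?thesis using less[OF bj(1) bi(1)] bi(3) bj(2) assms(3) by simp
    next
      case 2
      then have "block \<pi> i = block \<pi> j"
        using inj_onD[OF inj_on_Inf_partition[OF assms(1)]] bi(1) bj(1) by blast
      then show ?thesis using bi(3) bj(2) assms(3) by simp
    qed
  qed
qed

lemma block_eqI:
  fixes f :: "nat \<Rightarrow> nat set"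
  assumes \<rho>: "\<rho> = {f i | i. 1 \<le> i} - {{}}"
    and mono: "\<And>i j. 1 \<le> i \<Longrightarrow> i < j \<Longrightarrow> f j \<noteq> {} \<Longrightarrow> f i \<noteq> {} \<and> Inf (f i) < Inf (f j)"
    and "1 \<le> i"
  shows "block \<rho> i = f i"
proof -
  have rank: "card {C \<in> \<rho>. Inf C \<le> Inf (f k)} = k" if k: "1 \<le> k" "f k \<noteq> {}" for k
  proof -
    have "{C \<in> \<rho>. Inf C \<le> Inf (f k)} = f ` {1..k}"
    proof (intro equalityI subsetI)
      fix C assume "C \<in> {C \<in> \<rho>. Inf C \<le> Inf (f k)}"
      then obtain j where j: "1 \<le> j" "C = f j" "f j \<noteq> {}" "Inf (f j) \<le> Inf (f k)"
        unfolding \<rho> by auto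
      then have "j \<le> k" using mono[of k j] k by (meson leD leI)
      then show "C \<in> f ` {1..k}" using j by auto
    next
      fix C assume "C \<in> f ` {1..k}"
      then obtain j where j: "1 \<le> j" "j \<le> k" "C = f j" by auto
      then have "f j \<noteq> {} \<and> Inf (f j) \<le> Inf (f k)"
        using mono[of j k] k by (cases "j = k") auto
      then show "C \<in> {C \<in> \<rho>. Inf C \<le> Inf (f k)}" using j unfolding \<rho> by auto
    qed
    moreover have "inj_on f {1..k}"
    proof (rule linorder_inj_onI)
      fix x y assume xy: "x < y" "x \<in> {1..k}" "y \<in> {1..k}"
      then have "f y \<noteq> {}" using mono[of y k] k by (cases "y = k") auto
      then show "f x \<noteq> f y" using mono[of x y] xy by auto
    qed auto
    ultimately show ?thesis by (simp add: card_image)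
  qed
  have "{B \<in> \<rho>. card {C \<in> \<rho>. Inf C \<le> Inf B} = i} = {f i} - {{}}"
  proof (intro equalityI subsetI)
    fix B assume "B \<in> {B \<in> \<rho>. card {C \<in> \<rho>. Inf C \<le> Inf B} = i}"
    moreover from this obtain k where "1 \<le> k" "B = f k" "f k \<noteq> {}" unfolding \<rho> by auto
    ultimately show "B \<in> {f i} - {{}}" using rank[of k] by auto
  next
    fix B assume "B \<in> {f i} - {{}}"
    then have "B = f i" "f i \<noteq> {}" by auto
    moreover from this have "f i \<in> \<rho>" using \<open>1 \<le> i\<close> unfolding \<rho> by auto
    ultimately show "B \<in> {B \<in> \<rho>. card {C \<in> \<rho>. Inf C \<le> Inf B} = i}"
      using rank[OF \<open>1 \<le> i\<close>] by simp
  qed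
  then show ?thesis unfolding block_def by auto
qed

lemma block_coag:
  assumes "\<pi> \<in> partitions" "\<rho> \<in> partitions" "1 \<le> i"
  shows "block (coag \<pi> \<rho>) i = (\<Union>j\<in>block \<rho> i. block \<pi> j)"
proof (rule block_eqI[OF coag_def _ assms(3)])
  fix i j :: nat
  assume ij: "1 \<le> i" "i < j" and ne: "(\<Union>k\<in>block \<rho> j. block \<pi> k) \<noteq> {}"
  define f where "f = (\<lambda>i. \<Union>k\<in>block \<rho> i. block \<pi> k)"
  have pos: "1 \<le> k" if "k \<in> block \<rho> i" for k i
    using that assms(2) unfolding block_def partitions_def partition_on_def by auto
  define m where "m = Inf (block \<rho> i)"
  have nej: "block \<rho> j \<noteq> {}" using ne by auto
  note b = block_less[OF assms(2) ij nej]
  have m: "m \<in> block \<rho> i" unfolding m_def by (rule Inf_nat_in) (rule b)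
  have key: "block \<pi> m \<noteq> {} \<and> Inf (block \<pi> m) < x" if x: "x \<in> f j" for x
  proof -
    obtain k where k: "k \<in> block \<rho> j" "x \<in> block \<pi> k" using x by (auto simp: f_def)
    have "m < k" using b(2) Inf_nat_le[OF k(1)] by (simp add: m_def)
    then show ?thesis
      using block_less[OF assms(1) pos[OF m], of k] k(2) Inf_nat_le[OF k(2)] by fastforce
  qed
  have fj: "Inf (f j) \<in> f j" using ne unfolding f_def by (rule Inf_nat_in)
  have "Inf (block \<pi> m) \<in> f i" using key[OF fj] m Inf_nat_in by (auto simp: f_def)
  then have "f i \<noteq> {} \<and> Inf (f i) < Inf (f j)" using key[OF fj] Inf_nat_le by fastforce
  then show "(\<Union>k\<in>block \<rho> i. block \<pi> k) \<noteq> {} \<and>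
      Inf (\<Union>k\<in>block \<rho> i. block \<pi> k) < Inf (\<Union>k\<in>block \<rho> j. block \<pi> k)"
    by (simp add: f_def)
qed


subsection \<open>Simultaneous points\<close>

text \<open>The jumps of a flow carry one mark per jump time, whereas the definition of a lookdown graph
  does not by itself exclude two points with the same time coordinate.  A lookdown graph with two
  simultaneous points is not the set of jumps of any flow, and such graphs exist.\<close>

lemma inj_on_fst_jumps: "inj_on fst (jumps \<pi>)"
  by (auto simp: jumps_def inj_on_def)

lemma lookdown_graph_simultaneous: "\<exists>p\<in>lookdown_graphs. \<not> inj_on fst p"
proof -
  define v :: "nat \<Rightarrow> nat" where "v = (\<lambda>i\<in>{1..}. 1)"
  define w :: "nat \<Rightarrow> nat" where "w = (\<lambda>i\<in>{1..}. if i \<le> 2 then 1 else 0)"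
  have "v 1 = 1 \<and> v 2 = 1" "w 1 = 1 \<and> w 2 = 1" by (auto simp: v_def w_def)
  moreover have "v \<in> {1..} \<rightarrow>\<^sub>E {0, 1}" "w \<in> {1..} \<rightarrow>\<^sub>E {0, 1}" by (auto simp: v_def w_def)
  moreover have "(1::nat) \<noteq> 2" "(1::nat) \<le> 1" "(1::nat) \<le> 2" by auto
  ultimately have "v \<in> marks" "w \<in> marks" unfolding marks_def by blast+
  moreover have "v 3 \<noteq> w 3" by (simp add: v_def w_def)
  then have "v \<noteq> w" by metis
  ultimately show ?thesis
    by (intro bexI[of _ "{(0, v), (0, w)}"]) (auto simp: lookdown_graphs_def)
qed

lemma not_bij_betw_all_lookdown_graphs: "\<not> bij_betw jumps flows lookdown_graphs"
  using lookdown_graph_simultaneous inj_on_fst_jumps unfolding bij_betw_def by (metis imageE)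

end

theory Submission
  imports Defs
begin

text \<open>A partition with blocks ordered by least element is encoded by the function that sends an
  integer to the index of its block; these functions are the restricted growth functions, coagulation
  becomes composition, and closeness of partitions becomes agreement on an initial segment
  \<open>{..n}\<close>.  A flow is thus a family \<open>a r t = a r s \<circ> a s t\<close>.  On \<open>{..n}\<close> the regularity axioms make it
  the identity strictly before and strictly after each time, up to the left limit at that time, so by
  compactness of \<open>[s, t]\<close> only finitely many jumps are visible on \<open>{..n}\<close>, and \<open>a s t\<close> is the ordered
  composition of them.  Since a jump merges a single block, it is determined by its mark.  Conversely,
  composing the jumps of a lookdown graph in order of time, separately for each \<open>n\<close>, is consistent
  and defines a flow.\<close>

section \<open>Partitions as restricted growth functions\<close>

text \<open>\<open>A j\<close> stands for the rank of the block of \<open>j\<close>; ranks appear in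
  increasing order, which encodes the ordering by least element. At \<open>j = 0\<close> the second
  clause forces \<open>A 0 = 0\<close>, a dummy index for the integer 0 outside the ground
  set.\<close>

definition restricted_growth :: "(nat \<Rightarrow> nat) \<Rightarrow> bool" where
  "restricted_growth A \<longleftrightarrow> (\<forall>j>0. 0 < A j) \<and> (\<forall>j. \<forall>k<A j. \<exists>i<j. A i = k)"

text \<open>Index 0 is left out because its fibre is \<open>{0}\<close> for a restricted growth
  function. Empty fibres occur when there are finitely many blocks.\<close>

definition fibres :: "(nat \<Rightarrow> nat) \<Rightarrow> nat set set" where
  "fibres A = {A -` {i} | i. 1 \<le> i} - {{}}"

definition agree_upto :: "nat \<Rightarrow> (nat \<Rightarrow> nat) \<Rightarrow> (nat \<Rightarrow> nat) \<Rightarrow> bool" where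
  "agree_upto n A B \<longleftrightarrow> (\<forall>j\<le>n. A j = B j)"

lemma agree_upto_refl [simp]: "agree_upto n A A"
  and agree_upto_sym: "agree_upto n A B \<Longrightarrow> agree_upto n B A"
  and agree_upto_trans [trans]: "agree_upto n A B \<Longrightarrow> agree_upto n B C \<Longrightarrow> agree_upto n A C"
  and agree_upto_mono: "agree_upto n A B \<Longrightarrow> m \<le> n \<Longrightarrow> agree_upto m A B"
  by (auto simp: agree_upto_def)

lemma agree_upto_all: "(\<And>n. agree_upto n A B) \<Longrightarrow> A = B"
  by (auto simp: agree_upto_def)

lemma restricted_growth_0_iff [simp]: "restricted_growth A \<Longrightarrow> A j = 0 \<longleftrightarrow> j = 0"
  unfolding restricted_growth_def by (metis not_less_zero neq0_conv)

lemma restricted_growth_0 [simp]: "restricted_growth A \<Longrightarrow> A 0 = 0"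
  by simp

lemma restricted_growth_pos: "restricted_growth A \<Longrightarrow> 1 \<le> j \<Longrightarrow> 1 \<le> A j"
  by (simp add: restricted_growth_def Suc_le_eq)

text \<open>The values below \<open>A j\<close> are all attained among the \<open>j\<close> integers
  below \<open>j\<close>. Hence \<open>{..n}\<close> is mapped into itself, which lets compositions
  be studied on each initial segment separately.\<close>

lemma restricted_growth_le:
  assumes "restricted_growth A" shows "A j \<le> j"
proof -
  have "{..<A j} \<subseteq> A ` {..<j}"
    using assms by (fastforce simp: restricted_growth_def)
  then have "card {..<A j} \<le> card {..<j}" by (rule surj_card_le[rotated]) simp
  then show ?thesis by simp
qed

lemma restricted_growth_id [simp]: "restricted_growth id"
  by (simp add: restricted_growth_def)

lemma restricted_growth_comp:
  assumes "restricted_growth A" "restricted_growth B"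
  shows "restricted_growth (A \<circ> B)"
  unfolding restricted_growth_def
proof (intro conjI allI impI)
  fix j k assume "k < (A \<circ> B) j"
  then have "k < A (B j)" by simp
  then obtain i where i: "i < B j" "A i = k" using assms(1) unfolding restricted_growth_def by blast
  then obtain i' where "i' < j" "B i' = i"
    using assms(2) unfolding restricted_growth_def by blast
  with i show "\<exists>i<j. (A \<circ> B) i = k" by auto
qed (use assms in \<open>simp add: restricted_growth_def\<close>)

lemma agree_upto_comp:
  assumes "agree_upto n A A'" "agree_upto n B B'" "restricted_growth B"
  shows "agree_upto n (A \<circ> B) (A' \<circ> B')"
  unfolding agree_upto_def
proof (intro allI impI)
  fix j assume "j \<le> n"
  moreover from this have "B j \<le> n" using restricted_growth_le[OF assms(3), of j] by simp
  ultimately show "(A \<circ> B) j = (A' \<circ> B') j" using assms(1,2) by (simp add: agree_upto_def)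
qed

text \<open>The equality pattern determines a growth function, since each value either repeats an
  earlier one or is the least one not yet used.\<close>

lemma agree_upto_if_same_fibres:
  assumes "restricted_growth A" "restricted_growth B"
    and eq: "\<And>i j. i \<le> n \<Longrightarrow> j \<le> n \<Longrightarrow> A i = A j \<longleftrightarrow> B i = B j"
  shows "agree_upto n A B"
proof -
  have "A j = B j" if "j \<le> n" for j
    using that
  proof (induction j rule: less_induct)
    case (less j)
    \<comment> \<open>Symmetric in the two functions: were \<open>C j\<close> smaller,
      \<open>D\<close> would take the value \<open>C j\<close> at an earlier \<open>i\<close>, where
      both agree by induction, and equal patterns would give \<open>D i = D j\<close>.\<close>
    have *: "\<not> C j < D j" if "C = A \<and> D = B \<or> C = B \<and> D = A" for C D
    proof
      assume "C j < D j"
      moreover have "restricted_growth D" using that assms(1,2) by auto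
      ultimately obtain i where i: "i < j" "D i = C j" unfolding restricted_growth_def by blast
      then have "C i = C j" using less.IH[of i] less.prems that by auto
      then have "D i = D j" using eq[of i j] i(1) less.prems that by auto
      then show False using i(2) \<open>C j < D j\<close> by simp
    qed
    show ?case using *[of A B] *[of B A] by simp
  qed
  then show ?thesis by (simp add: agree_upto_def)
qed

section \<open>Blocks and coagulation in terms of growth functions\<close>

text \<open>Each element of a fibre is preceded by an element of every fibre of smaller positive
  index, so the least elements increase with the index.\<close>

lemma block_fibres:
  assumes "restricted_growth A" "1 \<le> i"
  shows "block (fibres A) i = A -` {i}"
proof (rule block_eqI[OF fibres_def _ assms(2)])
  fix i j assume ij: "1 \<le> i" "i < j" "A -` {j} \<noteq> {}"
  have "\<exists>k<x. k \<in> A -` {i}" if "x \<in> A -` {j}" for x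
    using that assms(1) ij by (auto simp: restricted_growth_def)
  moreover have "Inf (A -` {j}) \<in> A -` {j}" using ij(3) by (rule Inf_nat_in)
  ultimately obtain k where "k < Inf (A -` {j})" "k \<in> A -` {i}" by blast
  then show "A -` {i} \<noteq> {} \<and> Inf (A -` {i}) < Inf (A -` {j})"
    using Inf_nat_le[of k "A -` {i}"] by auto
qed

lemma fibres_in_partitions:
  assumes "restricted_growth A"
  shows "fibres A \<in> partitions"
  unfolding partitions_def mem_Collect_eq
proof (rule partition_onI)
  show "\<Union>(fibres A) = {1..}"
  proof (intro equalityI subsetI)
    fix x assume "x \<in> \<Union>(fibres A)"
    then have "A x \<noteq> 0" by (auto simp: fibres_def)
    then show "x \<in> {1..}" using assms by (cases x) auto
  next
    fix x :: nat assume "x \<in> {1..}"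
    then have "1 \<le> A x" using assms by (auto simp: restricted_growth_def Suc_le_eq)
    then show "x \<in> \<Union>(fibres A)" by (auto simp: fibres_def)
  qed
qed (auto simp: fibres_def disjnt_iff)

text \<open>Surjectivity of the encoding: each integer is sent to the rank of its block.\<close>

lemma partition_eq_fibres:
  assumes "\<pi> \<in> partitions"
  obtains A where "restricted_growth A" "\<pi> = fibres A"
proof -
  have P: "partition_on {1..} \<pi>" using assms by (simp add: partitions_def)
  have mem: "block \<pi> i \<in> \<pi>" if "j \<in> block \<pi> i" for i j
    using that by (cases rule: block_cases[OF assms, of i]) auto
  have pos: "1 \<le> i" if j: "j \<in> block \<pi> i" for i j
  proof (cases rule: block_cases[OF assms, of i])
    case 2
    have "block \<pi> i \<in> {C \<in> \<pi>. Inf C \<le> Inf (block \<pi> i)}" using 2(1) by simp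
    then have "card {C \<in> \<pi>. Inf C \<le> Inf (block \<pi> i)} \<noteq> 0"
      using finite_Inf_le_partition[OF assms, of "Inf (block \<pi> i)"] unfolding card_eq_0_iff by blast
    then show ?thesis using 2(3) by simp
  qed (use j in auto)
  have ex: "\<exists>i. j \<in> block \<pi> i" if "1 \<le> j" for j
  proof -
    have "j \<in> \<Union>\<pi>" unfolding partition_onD1[OF P, symmetric] using that by simp
    then obtain B where B: "B \<in> \<pi>" "j \<in> B" by blast
    define i where "i = card {C \<in> \<pi>. Inf C \<le> Inf B}"
    have "B \<subseteq> block \<pi> i" unfolding block_def i_def using B by blast
    then show ?thesis using B by blast
  qed
  have less: False if "i < i'" "j \<in> block \<pi> i" "j \<in> block \<pi> i'" for i i' j
  proof -
    have "block \<pi> i = block \<pi> i'"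
      using disjointD[OF partition_onD2[OF P] mem mem] that by blast
    moreover have "Inf (block \<pi> i) < Inf (block \<pi> i')"
      by (rule block_less[OF assms]) (use that pos in auto)
    ultimately show False by simp
  qed
  have uniq: "i = i'" if "j \<in> block \<pi> i" "j \<in> block \<pi> i'" for i i' j
    using less[of i i' j] less[of i' i j] that by (metis nat_neq_iff)
  \<comment> \<open>No block contains 0, so the description would be unspecified there; 0 is the
    value that \<open>restricted_growth\<close> requires.\<close>
  define A where "A j = (if j = 0 then 0 else THE i. j \<in> block \<pi> i)" for j
  have A: "j \<in> block \<pi> i \<longleftrightarrow> A j = i" if "1 \<le> j" for i j
  proof -
    have "j \<in> block \<pi> (A j)"
      using that theI'[of "\<lambda>i. j \<in> block \<pi> i"] ex[OF that] uniq unfolding A_def by fastforce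
    then show ?thesis using uniq by blast
  qed
  have sub: "block \<pi> i \<subseteq> {1..}" for i
    using mem partition_onD1[OF P] by blast
  have R: "restricted_growth A"
    unfolding restricted_growth_def
  proof (intro conjI allI impI)
    fix j :: nat assume "0 < j"
    then show "0 < A j" using pos[of j "A j"] A[of j "A j"] by simp
  next
    fix j k assume k: "k < A j"
    then have j: "1 \<le> j" by (cases j) (auto simp: A_def)
    show "\<exists>i<j. A i = k"
    proof (cases "k = 0")
      case True
      then show ?thesis using j by (intro exI[of _ 0]) (auto simp: A_def)
    next
      case False
      \<comment> \<open>The least element of the \<open>k\<close>-th block is the required earlier
        integer: it lies below the least element of the block of \<open>j\<close>, hence below
        \<open>j\<close>.\<close>
      have jb: "j \<in> block \<pi> (A j)" using A j by blast
      have b: "block \<pi> k \<noteq> {}" "Inf (block \<pi> k) < Inf (block \<pi> (A j))"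
        by (rule block_less[OF assms]; use False k jb in auto)+
      have "Inf (block \<pi> k) \<in> block \<pi> k" using b(1) by (rule Inf_nat_in)
      moreover from this have "1 \<le> Inf (block \<pi> k)" using sub by auto
      ultimately show ?thesis using A b(2) Inf_nat_le[OF jb] by (meson order.strict_trans2)
    qed
  qed
  have fib: "A -` {i} = block \<pi> i" if "1 \<le> i" for i
  proof (intro set_eqI iffI)
    fix x assume "x \<in> A -` {i}"
    moreover from this that have "1 \<le> x" using restricted_growth_0[OF R] by (cases x) auto
    ultimately show "x \<in> block \<pi> i" using A by simp
  next
    fix x assume x: "x \<in> block \<pi> i"
    then have "1 \<le> x" using sub by auto
    then show "x \<in> A -` {i}" using A x by simp
  qed
  have "\<pi> = fibres A"
  proof (intro equalityI subsetI)
    fix B assume B: "B \<in> \<pi>"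
    then have "B \<noteq> {}" "B \<subseteq> {1..}" using P unfolding partition_on_def by blast+
    then obtain j where j: "j \<in> B" "1 \<le> j" by auto
    have jb: "j \<in> block \<pi> (A j)" using A j by blast
    then have "B = block \<pi> (A j)" using disjointD[OF partition_onD2[OF P] B mem] j by blast
    then show "B \<in> fibres A" using fib pos[OF jb] j unfolding fibres_def by blast
  next
    fix B assume "B \<in> fibres A"
    then obtain i x where "B = block \<pi> i" "x \<in> B" using fib unfolding fibres_def by blast
    then show "B \<in> \<pi>" using mem by blast
  qed
  with R show ?thesis using that by blast
qed

text \<open>The \<open>j\<close>-th block of \<open>fibres A\<close> goes into the merged block of
  index \<open>B j\<close>. The second argument of \<open>coag\<close> thus becomes the outer
  function, which is why flows compose as \<open>a r s \<circ> a s t\<close>.\<close>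

lemma coag_fibres:
  assumes "restricted_growth A" "restricted_growth B"
  shows "coag (fibres A) (fibres B) = fibres (B \<circ> A)"
proof -
  have "(\<Union>j\<in>block (fibres B) i. block (fibres A) j) = (B \<circ> A) -` {i}" if "1 \<le> i" for i
  proof -
    have "1 \<le> j" if "j \<in> B -` {i}" for j
      using that \<open>1 \<le> i\<close> restricted_growth_0[OF assms(2)] by (cases j) auto
    then have "(\<Union>j\<in>B -` {i}. block (fibres A) j) = (\<Union>j\<in>B -` {i}. A -` {j})"
      using block_fibres[OF assms(1)] by simp
    then show ?thesis using block_fibres[OF assms(2) that] by auto
  qed
  then show ?thesis unfolding coag_def fibres_def[of "B \<circ> A"] by (metis (no_types, lifting))
qed

section \<open>Restrictions, distance and convergence\<close>

lemma restrict_partitionI: "B \<in> \<pi> \<Longrightarrow> x \<in> B \<inter> {1..n} \<Longrightarrow> B \<inter> {1..n} \<in> restrict_partition n \<pi>"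
  unfolding restrict_partition_def by blast

text \<open>Translates the restrictions in \<open>partition_dist\<close> into growth functions. One
  direction recovers the equality pattern from the restriction; the other compares the traces of the
  fibres on \<open>{1..n}\<close>.\<close>

lemma restrict_partition_fibres_eq_iff:
  assumes "restricted_growth A" "restricted_growth B"
  shows "restrict_partition n (fibres A) = restrict_partition n (fibres B) \<longleftrightarrow> agree_upto n A B"
proof
  assume eq: "restrict_partition n (fibres A) = restrict_partition n (fibres B)"
  \<comment> \<open>The case \<open>i = j\<close> is listed apart because 0 belongs to no block of a
    restriction.\<close>
  have char: "C i = C j \<longleftrightarrow> i = j \<or> (\<exists>D\<in>restrict_partition n (fibres C). i \<in> D \<and> j \<in> D)"
    if "restricted_growth C" "i \<le> n" "j \<le> n" for C i j
  proof
    assume "C i = C j"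
    moreover from this have "i = 0 \<longleftrightarrow> j = 0" using that by (metis restricted_growth_0_iff)
    ultimately show "i = j \<or> (\<exists>D\<in>restrict_partition n (fibres C). i \<in> D \<and> j \<in> D)"
    proof (cases "i = 0")
      case False
      have "1 \<le> C i" using False by (intro restricted_growth_pos[OF that(1)]) simp
      then have "C -` {C i} \<in> fibres C" unfolding fibres_def by auto
      moreover have ij: "i \<in> C -` {C i} \<inter> {1..n}" "j \<in> C -` {C i} \<inter> {1..n}"
        using that False \<open>i = 0 \<longleftrightarrow> j = 0\<close> \<open>C i = C j\<close> by auto
      ultimately have "C -` {C i} \<inter> {1..n} \<in> restrict_partition n (fibres C)"
        by (metis restrict_partitionI)
      with ij show ?thesis by metis
    qed auto
  next
    assume "i = j \<or> (\<exists>D\<in>restrict_partition n (fibres C). i \<in> D \<and> j \<in> D)"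
    then show "C i = C j" by (auto simp: restrict_partition_def fibres_def)
  qed
  show "agree_upto n A B"
    by (rule agree_upto_if_same_fibres[OF assms]) (simp add: char assms eq)
next
  assume ag: "agree_upto n A B"
  have "restrict_partition n (fibres C) \<subseteq> restrict_partition n (fibres D)"
    if "agree_upto n C D" for C D
  proof
    fix X assume "X \<in> restrict_partition n (fibres C)"
    then obtain B where B: "B \<in> fibres C" "X = B \<inter> {1..n}" "X \<noteq> {}"
      unfolding restrict_partition_def by blast
    from B(1) obtain i where "1 \<le> i" "B = C -` {i}" unfolding fibres_def by blast
    with B have i: "1 \<le> i" "X = C -` {i} \<inter> {1..n}" "X \<noteq> {}" by simp_all
    then have "X = D -` {i} \<inter> {1..n}" using that by (auto simp: agree_upto_def)
    moreover from this i have "D -` {i} \<in> fibres D" unfolding fibres_def by blast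
    ultimately show "X \<in> restrict_partition n (fibres D)"
      using i(3) restrict_partitionI[of "D -` {i}" "fibres D" _ n] by blast
  qed
  from this[OF ag] this[OF agree_upto_sym[OF ag]]
  show "restrict_partition n (fibres A) = restrict_partition n (fibres B)" by simp
qed

lemma fibres_eq_iff:
  assumes "restricted_growth A" "restricted_growth B"
  shows "fibres A = fibres B \<longleftrightarrow> A = B"
  using restrict_partition_fibres_eq_iff[OF assms] agree_upto_all by metis

lemma fibres_id: "fibres id = singletons"
  by (auto simp: fibres_def singletons_def)

lemma fibres_eq_singletons_iff:
  "restricted_growth A \<Longrightarrow> fibres A = singletons \<longleftrightarrow> A = id"
  using fibres_eq_iff[of A id] by (simp add: fibres_id)

text \<open>Distance below \<open>2 powr (- real n)\<close> forces agreement up to \<open>n\<close>,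
  and agreement up to \<open>n\<close> bounds the distance by that number. The encoding of
  \<open>f\<close> is assumed only eventually because flows are encoded only at pairs
  \<open>(s, t)\<close> with \<open>s \<le> t\<close>.\<close>

lemma limitin_fibres:
  assumes L: "restricted_growth L" and f: "\<forall>\<^sub>F x in F. restricted_growth (A x) \<and> f x = fibres (A x)"
  shows "limitin partition_topology f (fibres L) F \<longleftrightarrow> (\<forall>n. \<forall>\<^sub>F x in F. agree_upto n (A x) L)"
proof -
  have dist: "agree_upto n B L" if "restricted_growth B"
    "partition_dist (fibres B) (fibres L) < 2 powr (- real n)" for n B
    using fibres_in_partitions[OF that(1)] fibres_in_partitions[OF L]
  proof (cases rule: partition_dist_cases)
    case eq
    then show ?thesis using fibres_eq_iff[OF that(1) L] by simp
  next
    case (neq N)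
    then show ?thesis
      using that restrict_partition_fibres_eq_iff[OF that(1) L, of n] by simp
  qed
  have dist': "partition_dist (fibres B) (fibres L) \<le> 2 powr (- real n)"
    if "restricted_growth B" "agree_upto n B L" for n B
    using fibres_in_partitions[OF that(1)] fibres_in_partitions[OF L]
  proof (cases rule: partition_dist_cases)
    case (neq N)
    then show ?thesis
      using that restrict_partition_fibres_eq_iff[OF that(1) L, of n] by simp
  qed simp
  show ?thesis
    unfolding partitions.limitin_metric
  proof (intro iffI conjI allI impI)
    fix n
    assume "fibres L \<in> partitions \<and>
      (\<forall>\<epsilon>>0. \<forall>\<^sub>F x in F. f x \<in> partitions \<and> partition_dist (f x) (fibres L) < \<epsilon>)"
    then have "\<forall>\<^sub>F x in F. f x \<in> partitions \<and> partition_dist (f x) (fibres L) < 2 powr (- real n)"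
      by simp
    with f show "\<forall>\<^sub>F x in F. agree_upto n (A x) L"
      by eventually_elim (auto intro: dist)
  next
    show "fibres L \<in> partitions" using L by (rule fibres_in_partitions)
  next
    fix \<epsilon> :: real
    assume ag: "\<forall>n. \<forall>\<^sub>F x in F. agree_upto n (A x) L" and "0 < \<epsilon>"
    then obtain n where n: "(1/2) ^ n < \<epsilon>" using real_arch_pow_inv[of \<epsilon> "1/2"] by auto
    have "2 powr (- real n) = (1/2) ^ n" by (simp add: powr_minus powr_realpow power_divide field_simps)
    with n have n: "2 powr (- real n) < \<epsilon>" by simp
    from f ag[rule_format, of n]
    show "\<forall>\<^sub>F x in F. f x \<in> partitions \<and> partition_dist (f x) (fibres L) < \<epsilon>"
    proof eventually_elim
      case (elim x)
      then show ?case using dist'[of "A x" n] n fibres_in_partitions[of "A x"] by simp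
    qed
  qed
qed

subsection \<open>Single mergers and their marks\<close>

text \<open>For a growth function this is the union of the non-singleton blocks.\<close>

definition merged :: "(nat \<Rightarrow> nat) \<Rightarrow> nat set" where
  "merged A = {i. \<exists>j. j \<noteq> i \<and> A i = A j}"

definition single_merger :: "(nat \<Rightarrow> nat) \<Rightarrow> bool" where
  "single_merger A \<longleftrightarrow> restricted_growth A \<and> (\<forall>i\<in>merged A. \<forall>j\<in>merged A. A i = A j)"

definition mark :: "(nat \<Rightarrow> nat) \<Rightarrow> nat \<Rightarrow> nat" where
  "mark A = (\<lambda>i\<in>{1..}. if i \<in> merged A then 1 else 0)"

lemma single_merger_growth: "single_merger A \<Longrightarrow> restricted_growth A"
  by (simp add: single_merger_def)

lemma single_merger_id [simp]: "single_merger id"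
  by (simp add: single_merger_def merged_def)

lemma merged_pos:
  assumes "restricted_growth A" "i \<in> merged A"
  shows "1 \<le> i"
proof -
  obtain j where j: "j \<noteq> i" "A i = A j" using assms(2) by (auto simp: merged_def)
  then have "A j \<noteq> 0 \<or> i \<noteq> 0" using restricted_growth_0_iff[OF assms(1), of j] by auto
  then show ?thesis using j(2) restricted_growth_0_iff[OF assms(1), of i] by auto
qed

text \<open>The set \<open>merged A\<close> alone fixes the equality pattern, hence the whole
  function; this is why a mark determines its merger.\<close>

lemma single_merger_eq_iff:
  "single_merger A \<Longrightarrow> A i = A j \<longleftrightarrow> i = j \<or> i \<in> merged A \<and> j \<in> merged A"
  unfolding single_merger_def by (auto simp: merged_def)

lemma agree_upto_id_iff:
  assumes "single_merger A"
  shows "agree_upto n A id \<longleftrightarrow> (\<forall>i\<le>n. \<forall>j\<le>n. i \<in> merged A \<longrightarrow> j \<in> merged A \<longrightarrow> i = j)"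
    (is "_ \<longleftrightarrow> ?R")
proof
  assume "agree_upto n A id"
  then show ?R using single_merger_eq_iff[OF assms] by (metis agree_upto_def id_apply)
next
  assume R: ?R
  show "agree_upto n A id"
    by (rule agree_upto_if_same_fibres) (use R assms single_merger_eq_iff[OF assms] in \<open>auto simp: single_merger_def\<close>)
qed

lemma mark_eq_1_iff: "restricted_growth A \<Longrightarrow> mark A i = 1 \<and> 1 \<le> i \<longleftrightarrow> i \<in> merged A"
  using merged_pos[of A i] by (auto simp: mark_def)

lemma mark_PiE: "mark A \<in> {1..} \<rightarrow>\<^sub>E {0, 1}"
  by (auto simp: mark_def)

text \<open>Matches the local finiteness of lookdown graphs with that of the jumps visible on
  \<open>{..n}\<close>: two merged integers up to \<open>n\<close> are exactly what prevents
  agreement with \<open>id\<close>.\<close>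

lemma mark_in_marks_upto_iff:
  assumes "single_merger A"
  shows "mark A \<in> marks_upto n \<longleftrightarrow> \<not> agree_upto n A id"
proof -
  have "mark A \<in> marks_upto n \<longleftrightarrow> (\<exists>i\<le>n. \<exists>j\<le>n. i \<noteq> j \<and> i \<in> merged A \<and> j \<in> merged A)"
    using mark_PiE[of A] mark_eq_1_iff[OF single_merger_growth[OF assms]]
    unfolding marks_upto_def atLeastAtMost_iff Bex_def mem_Collect_eq by (metis (no_types, lifting))
  then show ?thesis using agree_upto_id_iff[OF assms, of n] by auto
qed

lemma mark_in_marks:
  assumes "single_merger A" "A \<noteq> id"
  shows "mark A \<in> marks"
proof -
  obtain n where "\<not> agree_upto n A id" using assms(2) agree_upto_all by blast
  then have "mark A \<in> marks_upto n" using mark_in_marks_upto_iff[OF assms(1)] by simp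
  then obtain i j where "i \<in> {1..n}" "j \<in> {1..n}" "i \<noteq> j" "mark A i = 1" "mark A j = 1"
    unfolding marks_upto_def by blast
  then show ?thesis using mark_PiE[of A] by (auto simp: marks_def)
qed

lemma mark_inject:
  assumes "single_merger A" "single_merger B" "mark A = mark B"
  shows "A = B"
proof -
  have "merged A = merged B"
    using mark_eq_1_iff assms by (metis (no_types, lifting) single_merger_growth set_eqI)
  then show ?thesis
    using agree_upto_if_same_fibres[of A B] assms single_merger_eq_iff agree_upto_all
      single_merger_growth by metis
qed

lemma mark_surj:
  assumes "v \<in> marks"
  obtains A where "single_merger A" "A \<noteq> id" "mark A = v"
proof -
  define S where "S = {i. 1 \<le> i \<and> v i = 1}"
  obtain x y where xy: "x \<in> S" "y \<in> S" "x \<noteq> y" using assms by (auto simp: marks_def S_def)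
  \<comment> \<open>The partition whose only block with several elements is the support of
    \<open>v\<close>; membership in \<open>marks\<close> provides two elements of
    \<open>S\<close>.\<close>
  define \<pi> where "\<pi> = insert S {{i} | i. 1 \<le> i \<and> i \<notin> S}"
  have "\<pi> \<in> partitions"
    unfolding partitions_def mem_Collect_eq
    by (rule partition_onI) (use xy in \<open>auto simp: \<pi>_def disjnt_iff S_def\<close>)
  then obtain A where A: "restricted_growth A" "\<pi> = fibres A" by (rule partition_eq_fibres)
  have char: "A i = A j \<longleftrightarrow> i = j \<or> i \<in> S \<and> j \<in> S" for i j
  proof (cases "i = 0 \<or> j = 0")
    case True
    moreover have "0 \<notin> S" by (simp add: S_def)
    ultimately show ?thesis using restricted_growth_0_iff[OF A(1)] by (metis restricted_growth_0[OF A(1)])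
  next
    case False
    have "A i = A j \<longleftrightarrow> (\<exists>B\<in>fibres A. i \<in> B \<and> j \<in> B)"
    proof
      assume "A i = A j"
      moreover have "1 \<le> A i" using False by (intro restricted_growth_pos[OF A(1)]) simp
      ultimately show "\<exists>B\<in>fibres A. i \<in> B \<and> j \<in> B"
        unfolding fibres_def by (intro bexI[of _ "A -` {A i}"]) auto
    qed (auto simp: fibres_def)
    also have "\<dots> \<longleftrightarrow> i = j \<or> i \<in> S \<and> j \<in> S"
      unfolding A(2)[symmetric] \<pi>_def using False by (cases "j \<in> S") (auto simp: Suc_le_eq)
    finally show ?thesis .
  qed
  then have m: "merged A = S" using xy unfolding merged_def by (auto, metis)
  then have "single_merger A" using A(1) char by (auto simp: single_merger_def)
  moreover have "A \<noteq> id" using m xy by (auto simp: merged_def)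
  moreover have "mark A = v"
    using m assms unfolding mark_def S_def marks_def by (auto simp: PiE_def extensional_def fun_eq_iff Pi_iff)
  ultimately show ?thesis using that by blast
qed

section \<open>The non-singleton block of a single merger\<close>

lemma not_singleton_fibre_iff:
  assumes "restricted_growth A" "B \<in> fibres A"
  shows "\<not> is_singleton B \<longleftrightarrow> B \<inter> merged A \<noteq> {}"
proof -
  obtain k x where B: "B = A -` {k}" "A x = k" using assms(2) unfolding fibres_def by blast
  have "is_singleton B \<longleftrightarrow> (\<forall>i\<in>B. \<forall>j\<in>B. i = j)"
    using B is_singletonI'[of B] by (metis is_singleton_def empty_iff singletonD singletonI vimage_singleton_eq)
  then show ?thesis unfolding B(1) merged_def by auto
qed

text \<open>All merged integers share one value, so a fibre that meets \<open>merged A\<close>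
  equals it. A merger other than \<open>id\<close> has a merged integer, which gives
  existence.\<close>

lemma non_singleton_fibre:
  assumes "single_merger A" "A \<noteq> id"
  shows "merged A \<in> fibres A \<and> \<not> is_singleton (merged A)"
    and "\<And>B. B \<in> fibres A \<Longrightarrow> \<not> is_singleton B \<Longrightarrow> B = merged A"
proof -
  have R: "restricted_growth A" using assms(1) by (rule single_merger_growth)
  show B: "B = merged A" if "B \<in> fibres A" "\<not> is_singleton B" for B
  proof -
    have "B \<inter> merged A \<noteq> {}" using that not_singleton_fibre_iff[OF R] by blast
    then obtain x where x: "x \<in> B" "x \<in> merged A" by blast
    from that(1) obtain k where "B = A -` {k}" unfolding fibres_def by blast
    with x(1) have "B = A -` {A x}" by simp
    then show ?thesis using x(2) single_merger_eq_iff[OF assms(1), of _ x] by auto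
  qed
  obtain n where "\<not> agree_upto n A id" using assms(2) agree_upto_all by blast
  then obtain x where x: "x \<in> merged A" using agree_upto_id_iff[OF assms(1)] by blast
  then have "1 \<le> A x" using merged_pos[OF R x] restricted_growth_pos[OF R] by simp
  then have "A -` {A x} \<in> fibres A" by (auto simp: fibres_def)
  moreover have "\<not> is_singleton (A -` {A x})"
    using x not_singleton_fibre_iff[OF R calculation] by blast
  ultimately show "merged A \<in> fibres A \<and> \<not> is_singleton (merged A)" using B by metis
qed

lemma non_singleton_block_fibres:
  assumes "single_merger A" "A \<noteq> id"
  shows "non_singleton_block (fibres A) = merged A"
  unfolding non_singleton_block_def
proof (rule the_equality)
  show "merged A \<in> fibres A \<and> \<not> is_singleton (merged A)"
    using non_singleton_fibre(1)[OF assms] .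
qed (use non_singleton_fibre(2)[OF assms] in blast)

text \<open>Connects \<open>single_merger\<close> with the condition on left limits in
  \<open>flows\<close>. For the converse, uniqueness of the block makes the fibres of any two merged
  integers coincide.\<close>

lemma single_merger_iff:
  assumes R: "restricted_growth A"
  shows "single_merger A \<longleftrightarrow>
    (\<exists>!B. B \<in> fibres A \<and> \<not> is_singleton B) \<or> fibres A = singletons"
proof
  assume "single_merger A"
  then show "(\<exists>!B. B \<in> fibres A \<and> \<not> is_singleton B) \<or> fibres A = singletons"
    using non_singleton_fibre fibres_eq_singletons_iff[OF R] by metis
next
  assume *: "(\<exists>!B. B \<in> fibres A \<and> \<not> is_singleton B) \<or> fibres A = singletons"
  show "single_merger A"
  proof (cases "A = id")
    case False
    have fib: "A -` {A i} \<in> fibres A \<and> \<not> is_singleton (A -` {A i})" if "i \<in> merged A" for i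
    proof -
      have "1 \<le> A i" using merged_pos[OF R that] by (rule restricted_growth_pos[OF R])
      then have "A -` {A i} \<in> fibres A" by (auto simp: fibres_def)
      then show ?thesis using not_singleton_fibre_iff[OF R] that by blast
    qed
    have "A i = A j" if "i \<in> merged A" "j \<in> merged A" for i j
    proof -
      have "A -` {A i} = A -` {A j}"
        using fib[OF that(1)] fib[OF that(2)] * False fibres_eq_singletons_iff[OF R] by blast
      then show ?thesis by blast
    qed
    then show ?thesis using R unfolding single_merger_def by blast
  qed simp
qed


section \<open>Flows of restricted growth functions\<close>

text \<open>The axioms of a flow for growth functions, with limits unfolded to agreement near each
  time. The left limits are a parameter \<open>J\<close>, so that uniqueness and existence can be
  stated for prescribed jumps.\<close>

locale growth_flow =
  fixes a :: "real \<Rightarrow> real \<Rightarrow> nat \<Rightarrow> nat" and J :: "real \<Rightarrow> nat \<Rightarrow> nat"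
  assumes growth: "s \<le> t \<Longrightarrow> restricted_growth (a s t)"
    and refl: "a s s = id"
    and comp: "r < s \<Longrightarrow> s < t \<Longrightarrow> a r t = a r s \<circ> a s t"
    and jump: "single_merger (J s)"
    and left: "\<exists>e>0. \<forall>r. s - e < r \<longrightarrow> r < s \<longrightarrow> agree_upto n (a r s) (J s)"
    and before: "\<exists>e>0. \<forall>r u. s - e < r \<longrightarrow> r < u \<longrightarrow> u < s \<longrightarrow> agree_upto n (a r u) id"
    and after: "\<exists>e>0. \<forall>t. s < t \<longrightarrow> t < s + e \<longrightarrow> agree_upto n (a s t) id"
begin

lemma comp_le: "r \<le> s \<Longrightarrow> s \<le> t \<Longrightarrow> a r t = a r s \<circ> a s t"
  using comp refl by (metis comp_id id_comp le_less)

lemma jump_growth: "restricted_growth (J s)"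
  using jump by (rule single_merger_growth)

text \<open>\<open>after\<close> concerns only intervals that begin at \<open>s\<close>. For later
  ones \<open>a s r\<close> is the identity on \<open>{..n}\<close>, so prefixing it to
  \<open>a r u\<close> changes nothing there and yields \<open>a s u\<close>.\<close>

lemma after_pairs:
  "\<exists>e>0. \<forall>r u. s < r \<longrightarrow> r < u \<longrightarrow> u < s + e \<longrightarrow> agree_upto n (a r u) id"
proof -
  obtain e where e: "e > 0" "\<And>t. s < t \<Longrightarrow> t < s + e \<Longrightarrow> agree_upto n (a s t) id"
    using after by blast
  have "agree_upto n (a r u) id" if "s < r" "r < u" "u < s + e" for r u
  proof -
    have "agree_upto n (a r u) (a s r \<circ> a r u)"
      using agree_upto_comp[OF agree_upto_sym[OF e(2)] agree_upto_refl growth, of r r u] that by simp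
    also have "a s r \<circ> a r u = a s u" using comp that by simp
    also have "agree_upto n \<dots> id" using e(2)[of u] that by simp
    finally show ?thesis .
  qed
  with e(1) show ?thesis by blast
qed

lemma jump_agrees_id:
  assumes "c < u" and id: "\<And>r. c < r \<Longrightarrow> r < u \<Longrightarrow> agree_upto n (a r u) id"
  shows "agree_upto n (J u) id"
proof -
  obtain e where e: "e > 0" "\<And>r. u - e < r \<Longrightarrow> r < u \<Longrightarrow> agree_upto n (a r u) (J u)"
    using left by blast
  obtain r where r: "max c (u - e) < r" "r < u"
    using dense[of "max c (u - e)" u] assms(1) e(1) by auto
  have "agree_upto n (J u) (a r u)" by (rule agree_upto_sym[OF e(2)]) (use r in auto)
  also have "agree_upto n (a r u) id" using id r by auto
  finally show ?thesis .
qed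

text \<open>Compactness in the form of \<open>Bolzano\<close> induction: finiteness passes to unions
  of adjacent intervals, and a short interval around \<open>x\<close> can have a visible jump only
  at \<open>x\<close> itself.\<close>

lemma finite_jumps: "finite {u \<in> {s..t}. \<not> agree_upto n (J u) id}"
proof (cases "s \<le> t")
  case True
  then show ?thesis
  proof (induction rule: Bolzano)
    case (trans a b c)
    have "{u \<in> {a..c}. \<not> agree_upto n (J u) id} \<subseteq>
      {u \<in> {a..b}. \<not> agree_upto n (J u) id} \<union> {u \<in> {b..c}. \<not> agree_upto n (J u) id}"
      by auto
    then show ?case using trans by (meson finite_UnI finite_subset)
  next
    case (local x)
    obtain e where e: "e > 0" "\<And>r u. x - e < r \<Longrightarrow> r < u \<Longrightarrow> u < x \<Longrightarrow> agree_upto n (a r u) id"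
      using before by blast
    obtain e' where e': "e' > 0" "\<And>r u. x < r \<Longrightarrow> r < u \<Longrightarrow> u < x + e' \<Longrightarrow> agree_upto n (a r u) id"
      using after_pairs by blast
    have id: "agree_upto n (J u) id" if "x - e < u" "u < x + e'" "u \<noteq> x" for u
    proof (cases "u < x")
      case True
      show ?thesis by (rule jump_agrees_id[of "x - e"]) (use True that e(2) in auto)
    next
      case False
      show ?thesis by (rule jump_agrees_id[of x]) (use False that e'(2) in auto)
    qed
    have "finite {u \<in> {b..c}. \<not> agree_upto n (J u) id}"
      if "b \<le> x" "x \<le> c" "c - b < min e e'" for b c
    proof -
      have "u = x" if u: "u \<in> {b..c}" "\<not> agree_upto n (J u) id" for u
        using id[of u] u \<open>b \<le> x\<close> \<open>x \<le> c\<close> \<open>c - b < min e e'\<close> by auto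
      then have "{u \<in> {b..c}. \<not> agree_upto n (J u) id} \<subseteq> {x}" by blast
      then show ?thesis by (rule finite_subset) simp
    qed
    moreover have "min e e' > 0" using e(1) e'(1) by simp
    ultimately show ?case by blast
  qed
qed simp

end

section \<open>Uniqueness of the flow with given jumps\<close>

text \<open>\<open>Bolzano\<close> induction reduces the claim to short intervals around a point
  \<open>x\<close>. After splitting at \<open>x\<close>, on \<open>{..n}\<close> a nontrivial left
  piece is \<open>J x\<close> and the right piece is \<open>id\<close> in both flows.\<close>

lemma growth_flow_unique:
  assumes "growth_flow a J" "growth_flow b J" "s \<le> t"
  shows "a s t = b s t"
proof (rule agree_upto_all)
  fix n
  interpret a: growth_flow a J by fact
  interpret b: growth_flow b J by fact
  show "agree_upto n (a s t) (b s t)"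
    using assms(3)
  proof (induction rule: Bolzano)
    case (trans r s t)
    then show ?case
      unfolding a.comp_le[OF trans(3,4)] b.comp_le[OF trans(3,4)]
      by (intro agree_upto_comp a.growth)
  next
    case (local x)
    obtain e1 where e1: "e1 > 0" "\<And>r. x - e1 < r \<Longrightarrow> r < x \<Longrightarrow> agree_upto n (a r x) (J x)"
      using a.left by blast
    obtain e2 where e2: "e2 > 0" "\<And>r. x - e2 < r \<Longrightarrow> r < x \<Longrightarrow> agree_upto n (b r x) (J x)"
      using b.left by blast
    obtain e3 where e3: "e3 > 0" "\<And>r. x < r \<Longrightarrow> r < x + e3 \<Longrightarrow> agree_upto n (a x r) id"
      using a.after by blast
    obtain e4 where e4: "e4 > 0" "\<And>r. x < r \<Longrightarrow> r < x + e4 \<Longrightarrow> agree_upto n (b x r) id"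
      using b.after by blast
    define d where "d = Min {e1, e2, e3, e4}"
    have "agree_upto n (a r u) (b r u)" if "r \<le> x" "x \<le> u" "u - r < d" for r u
    proof -
      have "agree_upto n (a r x) (b r x)"
      proof (cases "r = x")
        case False
        have "agree_upto n (a r x) (J x)" using False that e1(2) by (simp add: d_def)
        also have "agree_upto n (J x) (b r x)"
          by (rule agree_upto_sym[OF e2(2)]) (use False that in \<open>auto simp: d_def\<close>)
        finally show ?thesis .
      qed (simp add: a.refl b.refl)
      moreover have "agree_upto n (a x u) (b x u)"
      proof (cases "u = x")
        case False
        have "agree_upto n (a x u) id" using False that e3(2) by (simp add: d_def)
        also have "agree_upto n id (b x u)"
          by (rule agree_upto_sym[OF e4(2)]) (use False that in \<open>auto simp: d_def\<close>)
        finally show ?thesis .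
      qed (simp add: a.refl b.refl)
      ultimately have "agree_upto n (a r x \<circ> a x u) (b r x \<circ> b x u)"
        using agree_upto_comp a.growth[OF that(2)] by blast
      then show ?thesis
        using a.comp_le[OF that(1,2)] b.comp_le[OF that(1,2)] by simp
    qed
    then show ?case
      using e1(1) e2(1) e3(1) e4(1) by (intro exI[of _ d]) (auto simp: d_def)
  qed
qed


subsection \<open>Composing locally finitely many mergers\<close>

text \<open>\<open>foldr\<close> puts the earliest merger outermost, in accordance with
  \<open>a r t = a r s \<circ> a s t\<close>. Meant for finite \<open>U\<close>, since
  \<open>sorted_list_of_set\<close> lists only finite sets.\<close>

definition compose_over :: "(real \<Rightarrow> nat \<Rightarrow> nat) \<Rightarrow> real set \<Rightarrow> nat \<Rightarrow> nat" where
  "compose_over J U = foldr J (sorted_list_of_set U)"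

lemma restricted_growth_foldr:
  "(\<And>u. restricted_growth (J u)) \<Longrightarrow> restricted_growth (foldr J us)"
  by (induction us) (simp_all add: restricted_growth_comp)

lemma agree_upto_foldr_filter:
  assumes "\<And>u. restricted_growth (J u)"
    and "\<And>u. u \<in> set us \<Longrightarrow> \<not> P u \<Longrightarrow> agree_upto n (J u) id"
  shows "agree_upto n (foldr J (filter P us)) (foldr J us)"
  using assms(2)
proof (induction us)
  case (Cons u us)
  have IH: "agree_upto n (foldr J (filter P us)) (foldr J us)" using Cons by simp
  have G: "restricted_growth (foldr J (filter P us))"
    by (rule restricted_growth_foldr) (rule assms(1))
  show ?case
  proof (cases "P u")
    case True
    then show ?thesis using agree_upto_comp[OF agree_upto_refl IH G] by (simp add: comp_def)
  next
    case False
    then have "agree_upto n id (J u)" by (intro agree_upto_sym[OF Cons.prems]) simp_all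
    from agree_upto_comp[OF this IH G] show ?thesis using False by (simp add: comp_def)
  qed
qed simp

lemma compose_over_growth:
  "(\<And>u. restricted_growth (J u)) \<Longrightarrow> restricted_growth (compose_over J U)"
  unfolding compose_over_def by (rule restricted_growth_foldr)

lemma compose_over_empty [simp]: "compose_over J {} = id"
  and compose_over_singleton [simp]: "compose_over J {u} = J u"
  by (auto simp: compose_over_def)

lemma compose_over_Un:
  assumes "finite U" "finite V" "\<And>u v. u \<in> U \<Longrightarrow> v \<in> V \<Longrightarrow> u < v"
  shows "compose_over J (U \<union> V) = compose_over J U \<circ> compose_over J V"
proof -
  have "sorted_list_of_set (U \<union> V) = sorted_list_of_set U @ sorted_list_of_set V"
    by (rule sorted_distinct_set_unique)
      (use assms in \<open>auto simp: sorted_append less_imp_le dest: assms(3)\<close>)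
  then show ?thesis by (simp add: compose_over_def fun_eq_iff)
qed

text \<open>Supplies the coherence between levels: the additional jumps visible only at a higher
  level do not change the composition on the smaller segment.\<close>

lemma agree_upto_compose_over_subset:
  assumes "\<And>u. restricted_growth (J u)" "U \<subseteq> V" "finite V"
    and "\<And>u. u \<in> V - U \<Longrightarrow> agree_upto n (J u) id"
  shows "agree_upto n (compose_over J U) (compose_over J V)"
proof -
  have "sorted_list_of_set U = filter (\<lambda>u. u \<in> U) (sorted_list_of_set V)"
    by (rule sorted_distinct_set_unique)
      (use assms(2,3) finite_subset[OF assms(2,3)] in \<open>auto simp: sorted_wrt_filter\<close>)
  then show ?thesis
    unfolding compose_over_def using assms by (auto intro!: agree_upto_foldr_filter)
qed

text \<open>The two conditions at \<open>j\<close> involve only the values on \<open>{..j}\<close>,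
  so an approximation at level \<open>j\<close> suffices.\<close>

lemma restricted_growth_local:
  assumes "\<And>n. \<exists>B. restricted_growth B \<and> agree_upto n A B"
  shows "restricted_growth A"
  unfolding restricted_growth_def
proof (intro conjI allI impI)
  fix j :: nat assume "0 < j"
  moreover obtain B where "restricted_growth B" "agree_upto j A B" using assms by blast
  ultimately show "0 < A j" by (simp add: restricted_growth_def agree_upto_def)
next
  fix j k assume k: "k < A j"
  obtain B where B: "restricted_growth B" "agree_upto j A B" using assms by blast
  with k have "k < B j" by (simp add: agree_upto_def)
  then obtain i where "i < j" "B i = k" using B(1) unfolding restricted_growth_def by blast
  then show "\<exists>i<j. A i = k" using B(2) by (auto simp: agree_upto_def)
qed

lemma growth_flow_exists:
  assumes J: "\<And>u. single_merger (J u)"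
    and fin: "\<And>n s t. finite {u \<in> {s..t}. \<not> agree_upto n (J u) id}"
  obtains a where "growth_flow a J"
proof -
  \<comment> \<open>Open at \<open>s\<close> and closed at \<open>t\<close>: a jump at
    \<open>t\<close> must show in the left limit at \<open>t\<close>, while a jump at
    \<open>s\<close> must not show in \<open>a s t\<close>.\<close>
  define N where "N n s t = {u \<in> {s<..t}. \<not> agree_upto n (J u) id}" for n s t
  \<comment> \<open>Each coordinate \<open>j\<close> uses its own level \<open>j\<close>, where only
    finitely many jumps are visible; \<open>key\<close> shows that every higher level gives the same
    value.\<close>
  define a where "a s t j = compose_over J (N j s t) j" for s t j
  have G: "restricted_growth (J u)" for u using J by (rule single_merger_growth)
  have finN: "finite (N n s t)" for n s t
    by (rule finite_subset[OF _ fin[of s t n]]) (auto simp: N_def)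
  have key: "agree_upto n (a s t) (compose_over J (N n s t))" for n s t
    unfolding agree_upto_def
  proof (intro allI impI)
    fix j assume "j \<le> n"
    then have "agree_upto j (compose_over J (N j s t)) (compose_over J (N n s t))"
      by (intro agree_upto_compose_over_subset G finN)
        (auto simp: N_def intro: agree_upto_mono)
    then show "a s t j = compose_over J (N n s t) j" by (simp add: a_def agree_upto_def)
  qed
  have isolated: "\<exists>e>0. \<forall>u. s - e < u \<longrightarrow> u < s + e \<longrightarrow> u \<noteq> s \<longrightarrow> agree_upto n (J u) id" for n s
  proof -
    \<comment> \<open>Finiteness is applied to the window \<open>{s-1..s+1}\<close>, so the radius
      is later capped at 1.\<close>
    obtain d where d: "d > 0"
      "\<And>u. u \<in> {u \<in> {s-1..s+1}. \<not> agree_upto n (J u) id} \<Longrightarrow> u \<noteq> s \<Longrightarrow> d \<le> dist s u"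
      using finite_set_avoid[OF fin[of "s-1" "s+1" n], of s] by blast
    have "agree_upto n (J u) id" if "s - min d 1 < u" "u < s + min d 1" "u \<noteq> s" for u
    proof (rule ccontr)
      assume "\<not> agree_upto n (J u) id"
      then have "d \<le> dist s u" using that by (intro d(2)) auto
      then show False using that by (auto simp: dist_real_def abs_if split: if_splits)
    qed
    then show ?thesis using d(1) by (intro exI[of _ "min d 1"]) auto
  qed
  have "growth_flow a J"
  proof
    fix s t :: real
    show "restricted_growth (a s t)"
      by (rule restricted_growth_local, intro exI conjI, rule compose_over_growth[OF G], rule key)
  next
    fix s show "a s s = id" by (rule ext) (simp add: a_def N_def)
  next
    fix r s t :: real assume st: "r < s" "s < t"
    show "a r t = a r s \<circ> a s t"
    proof (rule agree_upto_all)
      fix n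
      have "N n r t = N n r s \<union> N n s t" using st by (auto simp: N_def)
      moreover have "compose_over J (N n r s \<union> N n s t) = compose_over J (N n r s) \<circ> compose_over J (N n s t)"
        by (rule compose_over_Un[OF finN finN]) (auto simp: N_def)
      ultimately have "agree_upto n (a r t) (compose_over J (N n r s) \<circ> compose_over J (N n s t))"
        using key[of n r t] by simp
      also have "agree_upto n \<dots> (a r s \<circ> a s t)"
        by (intro agree_upto_comp agree_upto_sym[OF key] compose_over_growth G)
      finally show "agree_upto n (a r t) (a r s \<circ> a s t)" .
    qed
  next
    fix s show "single_merger (J s)" by (rule J)
  next
    fix s n
    obtain e where e: "e > 0" "\<And>u. s - e < u \<Longrightarrow> u < s + e \<Longrightarrow> u \<noteq> s \<Longrightarrow> agree_upto n (J u) id"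
      using isolated by blast
    have "agree_upto n (a r s) (J s)" if r: "s - e < r" "r < s" for r
    proof -
      have "u = s" if "u \<in> N n r s" for u
        using e(1) e(2)[of u] r that by (auto simp: N_def)
      \<comment> \<open>The set may also be empty, namely when \<open>J s\<close> is invisible on
        \<open>{..n}\<close>; the comparison with \<open>{s}\<close> covers both cases.\<close>
      then have "N n r s \<subseteq> {s}" by blast
      then have "agree_upto n (compose_over J (N n r s)) (compose_over J {s})"
        by (rule agree_upto_compose_over_subset[OF G]) (use r in \<open>auto simp: N_def\<close>)
      then show ?thesis using agree_upto_trans[OF key] by simp
    qed
    then show "\<exists>e>0. \<forall>r. s - e < r \<longrightarrow> r < s \<longrightarrow> agree_upto n (a r s) (J s)" using e(1) by blast
    have "agree_upto n (a r u) id" if r: "s - e < r" "r < u" "u < s" for r u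
    proof -
      have "agree_upto n (J v) id" if "r < v" "v \<le> u" for v
        by (rule e(2)) (use r that in auto)
      then have "N n r u = {}" by (auto simp: N_def)
      with key[of n r u] show ?thesis by simp
    qed
    then show "\<exists>e>0. \<forall>r u. s - e < r \<longrightarrow> r < u \<longrightarrow> u < s \<longrightarrow> agree_upto n (a r u) id"
      using e(1) by blast
    have "agree_upto n (a s t) id" if r: "s < t" "t < s + e" for t
    proof -
      have "agree_upto n (J v) id" if "s < v" "v \<le> t" for v
        by (rule e(2)) (use r that in auto)
      then have "N n s t = {}" by (auto simp: N_def)
      with key[of n s t] show ?thesis by simp
    qed
    then show "\<exists>e>0. \<forall>t. s < t \<longrightarrow> t < s + e \<longrightarrow> agree_upto n (a s t) id" using e(1) by blast
  qed
  then show ?thesis using that by blast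
qed


section \<open>Flows of partitions\<close>

definition fibre_flow :: "(real \<Rightarrow> real \<Rightarrow> nat \<Rightarrow> nat) \<Rightarrow> real \<times> real \<Rightarrow> nat set set" where
  "fibre_flow a = (\<lambda>(s, t)\<in>{(s, t). s \<le> t}. fibres (a s t))"

lemma fibre_flow_apply: "s \<le> t \<Longrightarrow> fibre_flow a (s, t) = fibres (a s t)"
  by (simp add: fibre_flow_def)

lemma flowsD:
  assumes "\<pi> \<in> flows"
  shows "\<pi> \<in> {(s, t). s \<le> t} \<rightarrow>\<^sub>E partitions"
    and "r < s \<Longrightarrow> s < t \<Longrightarrow> \<pi> (r, t) = coag (\<pi> (s, t)) (\<pi> (r, s))"
    and "\<pi> (s, s) = singletons"
    and "\<exists>\<rho>. limitin partition_topology (\<lambda>r. \<pi> (r, s)) \<rho> (at_left s) \<and>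
      ((\<exists>!B. B \<in> \<rho> \<and> \<not> is_singleton B) \<or> \<rho> = singletons)"
    and "limitin partition_topology \<pi> singletons (at (t, t) within {(r, s). r < s \<and> s < t})"
    and "limitin partition_topology (\<lambda>t. \<pi> (s, t)) singletons (at_right s)"
proof -
  note F = assms[unfolded flows_def mem_Collect_eq]
  note F2 = F[THEN conjunct2] and F3 = F[THEN conjunct2, THEN conjunct2]
  note F4 = F3[THEN conjunct2]
  show "\<pi> \<in> {(s, t). s \<le> t} \<rightarrow>\<^sub>E partitions" by (rule F[THEN conjunct1])
  show "\<pi> (r, t) = coag (\<pi> (s, t)) (\<pi> (r, s))" if "r < s" "s < t"
    by (rule F2[THEN conjunct1, rule_format, OF that])
  show "\<pi> (s, s) = singletons" by (rule F3[THEN conjunct1, THEN spec, THEN conjunct1])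
  show "\<exists>\<rho>. limitin partition_topology (\<lambda>r. \<pi> (r, s)) \<rho> (at_left s) \<and>
      ((\<exists>!B. B \<in> \<rho> \<and> \<not> is_singleton B) \<or> \<rho> = singletons)"
    by (rule F3[THEN conjunct1, THEN spec, THEN conjunct2])
  show "limitin partition_topology \<pi> singletons (at (t, t) within {(r, s). r < s \<and> s < t})"
    by (rule F4[THEN conjunct1, THEN spec])
  show "limitin partition_topology (\<lambda>t. \<pi> (s, t)) singletons (at_right s)"
    by (rule F4[THEN conjunct2, THEN spec])
qed

section \<open>One-sided and diagonal limits in epsilon form\<close>

lemma eventually_at_left_iff:
  "eventually P (at_left (s::real)) \<longleftrightarrow> (\<exists>e>0. \<forall>r. s - e < r \<longrightarrow> r < s \<longrightarrow> P r)"
  unfolding eventually_at_left_field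
proof
  assume "\<exists>b<s. \<forall>y>b. y < s \<longrightarrow> P y"
  then obtain b where "b < s" "\<forall>y>b. y < s \<longrightarrow> P y" by blast
  then show "\<exists>e>0. \<forall>r. s - e < r \<longrightarrow> r < s \<longrightarrow> P r" by (intro exI[of _ "s - b"]) auto
next
  assume "\<exists>e>0. \<forall>r. s - e < r \<longrightarrow> r < s \<longrightarrow> P r"
  then obtain e where "e > 0" "\<forall>r. s - e < r \<longrightarrow> r < s \<longrightarrow> P r" by blast
  then show "\<exists>b<s. \<forall>y>b. y < s \<longrightarrow> P y" by (intro exI[of _ "s - e"]) auto
qed

lemma eventually_at_right_iff:
  "eventually P (at_right (s::real)) \<longleftrightarrow> (\<exists>e>0. \<forall>r. s < r \<longrightarrow> r < s + e \<longrightarrow> P r)"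
  unfolding eventually_at_right_field
proof
  assume "\<exists>b>s. \<forall>y>s. y < b \<longrightarrow> P y"
  then obtain b where "b > s" "\<forall>y>s. y < b \<longrightarrow> P y" by blast
  then show "\<exists>e>0. \<forall>r. s < r \<longrightarrow> r < s + e \<longrightarrow> P r" by (intro exI[of _ "b - s"]) auto
next
  assume "\<exists>e>0. \<forall>r. s < r \<longrightarrow> r < s + e \<longrightarrow> P r"
  then obtain e where "e > 0" "\<forall>r. s < r \<longrightarrow> r < s + e \<longrightarrow> P r" by blast
  then show "\<exists>b>s. \<forall>y>s. y < b \<longrightarrow> P y" by (intro exI[of _ "s + e"]) auto
qed

lemma eventually_at_diagonal_iff:
  "eventually P (at (t::real, t) within {(r, s). r < s \<and> s < t}) \<longleftrightarrow>
    (\<exists>e>0. \<forall>r s. t - e < r \<longrightarrow> r < s \<longrightarrow> s < t \<longrightarrow> P (r, s))"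
proof
  assume "eventually P (at (t, t) within {(r, s). r < s \<and> s < t})"
  then obtain d where d: "d > 0"
    "\<And>x. x \<in> {(r, s). r < s \<and> s < t} \<Longrightarrow> x \<noteq> (t, t) \<Longrightarrow> dist x (t, t) < d \<Longrightarrow> P x"
    unfolding eventually_at by blast
  \<comment> \<open>Half the radius suffices: both coordinates are within \<open>d / 2\<close> of
    \<open>t\<close>, and the distance in the plane is at most the sum of the coordinate
    distances.\<close>
  have "P (r, s)" if "t - d / 2 < r" "r < s" "s < t" for r s
  proof (rule d(2))
    have "dist (r, s) (t, t) \<le> dist r t + dist s t"
      unfolding dist_Pair_Pair by (rule sqrt_sum_squares_le_sum) auto
    also have "\<dots> < d" using that by (simp add: dist_real_def)
    finally show "dist (r, s) (t, t) < d" .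
  qed (use that in auto)
  then show "\<exists>e>0. \<forall>r s. t - e < r \<longrightarrow> r < s \<longrightarrow> s < t \<longrightarrow> P (r, s)"
    using d(1) by (intro exI[of _ "d / 2"]) auto
next
  assume "\<exists>e>0. \<forall>r s. t - e < r \<longrightarrow> r < s \<longrightarrow> s < t \<longrightarrow> P (r, s)"
  then obtain e where e: "e > 0" "\<And>r s. t - e < r \<Longrightarrow> r < s \<Longrightarrow> s < t \<Longrightarrow> P (r, s)" by blast
  \<comment> \<open>Only \<open>r\<close> has to be controlled, because \<open>s\<close> lies
    between \<open>r\<close> and \<open>t\<close>.\<close>
  have "P (r, s)" if "r < s" "s < t" "dist (r, s) (t, t) < e" for r s
  proof (rule e(2))
    have "dist r t < e" using dist_fst_le[of "(r, s)" "(t, t)"] that(3) by simp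
    then show "t - e < r" by (auto simp: dist_real_def)
  qed (use that in auto)
  then show "eventually P (at (t, t) within {(r, s). r < s \<and> s < t})"
    unfolding eventually_at using e(1) by (intro exI[of _ e]) auto
qed

text \<open>Serves in both directions, to read the axioms off a given flow and to verify them for a
  constructed one. It is stated for any \<open>\<pi>\<close> that \<open>a\<close> encodes, so it
  applies before \<open>\<pi> = fibre_flow a\<close> is known.\<close>

lemma limitin_fibre_flow:
  fixes a :: "real \<Rightarrow> real \<Rightarrow> nat \<Rightarrow> nat"
  assumes a: "\<forall>s t. s \<le> t \<longrightarrow> restricted_growth (a s t) \<and> \<pi> (s, t) = fibres (a s t)"
    and L: "restricted_growth L"
  shows "limitin partition_topology (\<lambda>r. \<pi> (r, s)) (fibres L) (at_left s) \<longleftrightarrow>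
      (\<forall>n. \<exists>e>0. \<forall>r. s - e < r \<longrightarrow> r < s \<longrightarrow> agree_upto n (a r s) L)"
    and "limitin partition_topology \<pi> (fibres L) (at (s, s) within {(r, t). r < t \<and> t < s}) \<longleftrightarrow>
      (\<forall>n. \<exists>e>0. \<forall>r u. s - e < r \<longrightarrow> r < u \<longrightarrow> u < s \<longrightarrow> agree_upto n (a r u) L)"
    and "limitin partition_topology (\<lambda>t. \<pi> (s, t)) (fibres L) (at_right s) \<longleftrightarrow>
      (\<forall>n. \<exists>e>0. \<forall>t. s < t \<longrightarrow> t < s + e \<longrightarrow> agree_upto n (a s t) L)"
proof -
  have "limitin partition_topology (\<lambda>r. \<pi> (r, s)) (fibres L) (at_left s) \<longleftrightarrow>
      (\<forall>n. \<forall>\<^sub>F r in at_left s. agree_upto n (a r s) L)"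
  proof (rule limitin_fibres[OF L])
    show "\<forall>\<^sub>F r in at_left s. restricted_growth (a r s) \<and> \<pi> (r, s) = fibres (a r s)"
      unfolding eventually_at_left_iff by (rule exI[of _ 1]) (simp add: a)
  qed
  then show "limitin partition_topology (\<lambda>r. \<pi> (r, s)) (fibres L) (at_left s) \<longleftrightarrow>
      (\<forall>n. \<exists>e>0. \<forall>r. s - e < r \<longrightarrow> r < s \<longrightarrow> agree_upto n (a r s) L)"
    by (simp add: eventually_at_left_iff)
  have "limitin partition_topology (\<lambda>t. \<pi> (s, t)) (fibres L) (at_right s) \<longleftrightarrow>
      (\<forall>n. \<forall>\<^sub>F t in at_right s. agree_upto n (a s t) L)"
  proof (rule limitin_fibres[OF L])
    show "\<forall>\<^sub>F t in at_right s. restricted_growth (a s t) \<and> \<pi> (s, t) = fibres (a s t)"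
      unfolding eventually_at_right_iff by (rule exI[of _ 1]) (simp add: a)
  qed
  then show "limitin partition_topology (\<lambda>t. \<pi> (s, t)) (fibres L) (at_right s) \<longleftrightarrow>
      (\<forall>n. \<exists>e>0. \<forall>t. s < t \<longrightarrow> t < s + e \<longrightarrow> agree_upto n (a s t) L)"
    by (simp add: eventually_at_right_iff)
  have "limitin partition_topology \<pi> (fibres L) (at (s, s) within {(r, t). r < t \<and> t < s}) \<longleftrightarrow>
      (\<forall>n. \<forall>\<^sub>F x in at (s, s) within {(r, t). r < t \<and> t < s}. agree_upto n (a (fst x) (snd x)) L)"
  proof (rule limitin_fibres[OF L])
    show "\<forall>\<^sub>F x in at (s, s) within {(r, t). r < t \<and> t < s}.
        restricted_growth (a (fst x) (snd x)) \<and> \<pi> x = fibres (a (fst x) (snd x))"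
      unfolding eventually_at_diagonal_iff by (rule exI[of _ 1]) (simp add: a)
  qed
  then show "limitin partition_topology \<pi> (fibres L) (at (s, s) within {(r, t). r < t \<and> t < s}) \<longleftrightarrow>
      (\<forall>n. \<exists>e>0. \<forall>r u. s - e < r \<longrightarrow> r < u \<longrightarrow> u < s \<longrightarrow> agree_upto n (a r u) L)"
    by (simp add: eventually_at_diagonal_iff)
qed

section \<open>From growth functions to flows and lookdown graphs\<close>

context growth_flow
begin

lemma fibre_flow_growth:
  "\<forall>s t. s \<le> t \<longrightarrow> restricted_growth (a s t) \<and> fibre_flow a (s, t) = fibres (a s t)"
  using growth fibre_flow_apply by blast

lemma limitin_left: "limitin partition_topology (\<lambda>r. fibre_flow a (r, s)) (fibres (J s)) (at_left s)"
  using limitin_fibre_flow(1)[OF fibre_flow_growth jump_growth] left by blast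

lemma left_limit_fibre_flow: "left_limit (fibre_flow a) s = fibres (J s)"
  unfolding left_limit_def
proof (rule the_equality)
  show "limitin partition_topology (\<lambda>r. fibre_flow a (r, s)) (fibres (J s)) (at_left s)"
    by (rule limitin_left)
next
  fix \<rho> assume "limitin partition_topology (\<lambda>r. fibre_flow a (r, s)) \<rho> (at_left s)"
  then show "\<rho> = fibres (J s)"
    using limitin_left by (rule partitions.limitin_metric_unique) simp
qed

lemma jumps_fibre_flow: "jumps (fibre_flow a) = {(s, mark (J s)) | s. J s \<noteq> id}"
proof -
  have "left_limit (fibre_flow a) s \<noteq> singletons \<longleftrightarrow> J s \<noteq> id" for s
    by (simp add: left_limit_fibre_flow fibres_eq_singletons_iff jump_growth)
  moreover have "jump_mark (fibre_flow a) s = mark (J s)" if "J s \<noteq> id" for s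
    using non_singleton_block_fibres[OF jump that]
    by (simp add: jump_mark_def mark_def left_limit_fibre_flow)
  ultimately show ?thesis unfolding jumps_def by (metis (lifting))
qed

lemma fibre_flow_in_flows: "fibre_flow a \<in> flows"
proof -
  note lims = limitin_fibre_flow[OF fibre_flow_growth restricted_growth_id, unfolded fibres_id]
  show ?thesis
    unfolding flows_def mem_Collect_eq
  proof (intro conjI allI impI)
    show "fibre_flow a \<in> {(s, t). s \<le> t} \<rightarrow>\<^sub>E partitions"
      by (auto simp: fibre_flow_def fibres_in_partitions growth)
  next
    fix r s t :: real assume "r < s" "s < t"
    then show "fibre_flow a (r, t) = coag (fibre_flow a (s, t)) (fibre_flow a (r, s))"
      using comp[of r s t] by (simp add: fibre_flow_apply coag_fibres growth)
  next
    fix s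
    show "fibre_flow a (s, s) = singletons" by (simp add: fibre_flow_apply refl fibres_id)
    have "(\<exists>!B. B \<in> fibres (J s) \<and> \<not> is_singleton B) \<or> fibres (J s) = singletons"
      by (rule iffD1[OF single_merger_iff[OF jump_growth] jump])
    with limitin_left[of s]
    show "\<exists>\<rho>. limitin partition_topology (\<lambda>r. fibre_flow a (r, s)) \<rho> (at_left s) \<and>
        ((\<exists>!B. B \<in> \<rho> \<and> \<not> is_singleton B) \<or> \<rho> = singletons)"
      by (intro exI conjI)
    show "limitin partition_topology (fibre_flow a) singletons
        (at (s, s) within {(r, t). r < t \<and> t < s})"
      unfolding lims(2) by (intro allI before)
    show "limitin partition_topology (\<lambda>t. fibre_flow a (s, t)) singletons (at_right s)"
      unfolding lims(3) by (intro allI after)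
  qed
qed

lemma jumps_in_lookdown_graphs: "jumps (fibre_flow a) \<in> lookdown_graphs"
proof -
  have sub: "jumps (fibre_flow a) \<inter> ({s..t} \<times> marks_upto n)
      \<subseteq> (\<lambda>u. (u, mark (J u))) ` {u \<in> {s..t}. \<not> agree_upto n (J u) id}" for s t n
    unfolding jumps_fibre_flow using mark_in_marks_upto_iff[OF jump] by auto
  have fin: "finite (jumps (fibre_flow a) \<inter> ({s..t} \<times> marks_upto n))" for s t n
    using finite_jumps by (rule finite_subset[OF sub finite_imageI])
  \<comment> \<open>Countability: every jump lies in a bounded time window and is visible at some
    level, so countably many finite sets exhaust the jumps.\<close>
  have "jumps (fibre_flow a) \<subseteq>
      (\<Union>k::nat. \<Union>n. jumps (fibre_flow a) \<inter> ({- real k..real k} \<times> marks_upto n))"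
  proof
    fix x assume x: "x \<in> jumps (fibre_flow a)"
    then obtain s where s: "x = (s, mark (J s))" "J s \<noteq> id" unfolding jumps_fibre_flow by blast
    obtain n where "\<not> agree_upto n (J s) id" using s(2) agree_upto_all by blast
    then have "mark (J s) \<in> marks_upto n" using mark_in_marks_upto_iff[OF jump] by blast
    moreover obtain k :: nat where "\<bar>s\<bar> \<le> real k" using real_arch_simple by blast
    then have "s \<in> {- real k..real k}" by auto
    ultimately show "x \<in> (\<Union>k::nat. \<Union>n. jumps (fibre_flow a) \<inter> ({- real k..real k} \<times> marks_upto n))"
      using x s(1) by blast
  qed
  moreover have "countable (\<Union>k::nat. \<Union>n. jumps (fibre_flow a) \<inter> ({- real k..real k} \<times> marks_upto n))"
    by (rule countable_UN[OF countableI_type])+ (rule countable_finite[OF fin])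
  ultimately have "countable (jumps (fibre_flow a))" by (rule countable_subset)
  moreover have "jumps (fibre_flow a) \<subseteq> UNIV \<times> marks"
    unfolding jumps_fibre_flow using mark_in_marks[OF jump] by blast
  ultimately show ?thesis using fin unfolding lookdown_graphs_def by blast
qed

end

text \<open>Growth functions are chosen for all pairs \<open>s \<le> t\<close>, and \<open>J\<close>
  encodes the left limits. The composition law transfers because the encoding is injective.\<close>

lemma flows_eq_fibre_flow:
  assumes "\<pi> \<in> flows"
  obtains a J where "growth_flow a J" "\<pi> = fibre_flow a"
proof -
  have ext: "\<pi> \<in> {(s, t). s \<le> t} \<rightarrow>\<^sub>E partitions" using assms by (rule flowsD)
  have "\<exists>A. restricted_growth A \<and> \<pi> (s, t) = fibres A" if "s \<le> t" for s t
  proof -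
    have "\<pi> (s, t) \<in> partitions" using ext that by (auto simp: PiE_def Pi_def)
    then show ?thesis using partition_eq_fibres by metis
  qed
  then obtain a where a: "\<And>s t. s \<le> t \<Longrightarrow> restricted_growth (a s t)"
    "\<And>s t. s \<le> t \<Longrightarrow> \<pi> (s, t) = fibres (a s t)"
    by metis
  then have "\<forall>s t. s \<le> t \<longrightarrow> restricted_growth (a s t) \<and> \<pi> (s, t) = fibres (a s t)" by blast
  note lims = limitin_fibre_flow[OF this]
  have "\<exists>L. single_merger L \<and> limitin partition_topology (\<lambda>r. \<pi> (r, s)) (fibres L) (at_left s)" for s
  proof -
    from flowsD(4)[OF assms, of s] obtain \<rho> where
      \<rho>: "limitin partition_topology (\<lambda>r. \<pi> (r, s)) \<rho> (at_left s) \<and>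
        ((\<exists>!B. B \<in> \<rho> \<and> \<not> is_singleton B) \<or> \<rho> = singletons)"
      by (rule exE)
    have "\<rho> \<in> partitions" using limitin_topspace[OF conjunct1[OF \<rho>]] by simp
    then obtain L where L: "restricted_growth L" "\<rho> = fibres L" by (rule partition_eq_fibres)
    have "single_merger L"
      by (rule iffD2[OF single_merger_iff[OF L(1)] conjunct2[OF \<rho>[unfolded L(2)]]])
    then show ?thesis using conjunct1[OF \<rho>] L(2) by blast
  qed
  then obtain J where J: "\<And>s. single_merger (J s)"
    "\<And>s. limitin partition_topology (\<lambda>r. \<pi> (r, s)) (fibres (J s)) (at_left s)"
    by metis
  have "growth_flow a J"
  proof
    fix s t :: real assume "s \<le> t"
    then show "restricted_growth (a s t)" by (rule a(1))
  next
    fix s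
    have "\<pi> (s, s) = singletons" using assms by (rule flowsD)
    then show "a s s = id" using a fibres_eq_singletons_iff by simp
  next
    fix r s t :: real assume st: "r < s" "s < t"
    have "\<pi> (r, t) = coag (\<pi> (s, t)) (\<pi> (r, s))" using assms st by (rule flowsD)
    then have "fibres (a r t) = fibres (a r s \<circ> a s t)"
      using st a by (simp add: coag_fibres)
    then show "a r t = a r s \<circ> a s t"
      using st a(1) by (subst (asm) fibres_eq_iff) (auto intro: restricted_growth_comp)
  next
    fix s show "single_merger (J s)" by (rule J)
  next
    fix s n
    show "\<exists>e>0. \<forall>r. s - e < r \<longrightarrow> r < s \<longrightarrow> agree_upto n (a r s) (J s)"
      using lims(1)[OF single_merger_growth[OF J(1)]] J(2) by blast
    have "limitin partition_topology \<pi> singletons (at (s, s) within {(r, u). r < u \<and> u < s})"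
      using assms by (rule flowsD)
    then show "\<exists>e>0. \<forall>r u. s - e < r \<longrightarrow> r < u \<longrightarrow> u < s \<longrightarrow> agree_upto n (a r u) id"
      using lims(2)[OF restricted_growth_id, of s] unfolding fibres_id by blast
    have "limitin partition_topology (\<lambda>t. \<pi> (s, t)) singletons (at_right s)"
      using assms by (rule flowsD)
    then show "\<exists>e>0. \<forall>t. s < t \<longrightarrow> t < s + e \<longrightarrow> agree_upto n (a s t) id"
      using lims(3)[OF restricted_growth_id, of s] unfolding fibres_id by blast
  qed
  moreover have "\<pi> = fibre_flow a"
    using ext a(2) by (auto simp: fibre_flow_def PiE_def extensional_def fun_eq_iff)
  ultimately show ?thesis using that by blast
qed

section \<open>Injectivity and surjectivity of the jump map\<close>

text \<open>The jump set tells at which times \<open>J\<close> differs from \<open>id\<close>, and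
  the mark recovers \<open>J\<close> there. \<open>growth_flow_unique\<close> then identifies the
  flows.\<close>

lemma inj_on_jumps: "inj_on jumps flows"
proof (rule inj_onI)
  fix \<pi> \<rho> assume "\<pi> \<in> flows" "\<rho> \<in> flows" and eq: "jumps \<pi> = jumps \<rho>"
  then obtain a J b K where a: "growth_flow a J" "\<pi> = fibre_flow a"
    and b: "growth_flow b K" "\<rho> = fibre_flow b" by (metis flows_eq_fibre_flow)
  interpret a: growth_flow a J by fact
  interpret b: growth_flow b K by fact
  have *: "{(s, mark (J s)) | s. J s \<noteq> id} = {(s, mark (K s)) | s. K s \<noteq> id}"
    using eq a(2) b(2) a.jumps_fibre_flow b.jumps_fibre_flow by simp
  have "J s = K s" for s
  proof (cases "J s = id")
    case True
    then have "(s, mark (K s)) \<notin> {(s, mark (K s)) | s. K s \<noteq> id}" unfolding *[symmetric] by blast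
    then show ?thesis using True by auto
  next
    case False
    then have "(s, mark (J s)) \<in> {(s, mark (K s)) | s. K s \<noteq> id}" unfolding *[symmetric] by blast
    then have "mark (J s) = mark (K s)" by blast
    then show ?thesis using mark_inject a.jump b.jump by blast
  qed
  then have "J = K" by blast
  then have "a s t = b s t" if "s \<le> t" for s t using growth_flow_unique a(1) b(1) that by blast
  then show "\<pi> = \<rho>" unfolding a(2) b(2) fibre_flow_def by (intro restrict_ext) auto
qed

text \<open>Injectivity of \<open>fst\<close> gives at most one mark per time, hence a well-defined
  merger \<open>J s\<close>, taken to be \<open>id\<close> where \<open>p\<close> has no point.
  Local finiteness of \<open>p\<close> allows these mergers to be composed.\<close>

lemma lookdown_graph_eq_jumps:
  assumes "p \<in> lookdown_graphs" "inj_on fst p"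
  shows "p \<in> jumps ` flows"
proof -
  have marks: "v \<in> marks" if "(s, v) \<in> p" for s v
    using that assms(1) by (auto simp: lookdown_graphs_def)
  have uniq: "v = w" if "(s, v) \<in> p" "(s, w) \<in> p" for s v w
    using inj_onD[OF assms(2) _ that] by simp
  have "\<exists>A. single_merger A \<and> (A \<noteq> id \<longleftrightarrow> (\<exists>v. (s, v) \<in> p)) \<and> (\<forall>v. (s, v) \<in> p \<longrightarrow> mark A = v)" for s
  proof (cases "\<exists>v. (s, v) \<in> p")
    case True
    then obtain v where v: "(s, v) \<in> p" by blast
    obtain A where "single_merger A" "A \<noteq> id" "mark A = v" using mark_surj[OF marks[OF v]] .
    then show ?thesis using v uniq by blast
  next
    case False
    then show ?thesis using single_merger_id by blast
  qed
  then obtain J where J: "\<And>s. single_merger (J s)" "\<And>s. J s \<noteq> id \<longleftrightarrow> (\<exists>v. (s, v) \<in> p)"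
    "\<And>s v. (s, v) \<in> p \<Longrightarrow> mark (J s) = v"
    by metis
  have fin: "finite {u \<in> {s..t}. \<not> agree_upto n (J u) id}" for n s t
  proof (cases "s \<le> t")
    case True
    \<comment> \<open>\<open>lookdown_graphs\<close> speaks only of levels from 2 on; a jump visible
      at level \<open>n\<close> is also visible at level \<open>max n 2\<close>.\<close>
    then have F: "finite (p \<inter> ({s..t} \<times> marks_upto (max n 2)))"
      using assms(1) by (auto simp: lookdown_graphs_def)
    have "{u \<in> {s..t}. \<not> agree_upto n (J u) id} \<subseteq> fst ` (p \<inter> ({s..t} \<times> marks_upto (max n 2)))"
    proof
      fix u assume "u \<in> {u \<in> {s..t}. \<not> agree_upto n (J u) id}"
      then have u: "u \<in> {s..t}" "\<not> agree_upto (max n 2) (J u) id"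
        using agree_upto_mono[of "max n 2" "J u" id n] by auto
      then have "J u \<noteq> id" by auto
      then obtain v where v: "(u, v) \<in> p" using J(2) by blast
      then have "v \<in> marks_upto (max n 2)" using J(3) mark_in_marks_upto_iff[OF J(1)] u(2) by blast
      with u(1) v show "u \<in> fst ` (p \<inter> ({s..t} \<times> marks_upto (max n 2)))" by force
    qed
    then show ?thesis using F by (meson finite_imageI finite_subset)
  qed simp
  obtain a where "growth_flow a J" using growth_flow_exists[OF J(1) fin] .
  then interpret growth_flow a J .
  have "jumps (fibre_flow a) = p"
    unfolding jumps_fibre_flow
  proof (intro equalityI subsetI)
    fix x assume "x \<in> {(s, mark (J s)) | s. J s \<noteq> id}"
    then obtain s where "x = (s, mark (J s))" "J s \<noteq> id" by blast
    then show "x \<in> p" using J(2)[of s] J(3) by metis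
  next
    fix x assume "x \<in> p"
    then show "x \<in> {(s, mark (J s)) | s. J s \<noteq> id}" using J(2,3) by (cases x) blast
  qed
  then show ?thesis using fibre_flow_in_flows by blast
qed

text \<open>The target consists of the graphs with at most one point per time: jump sets have this
  property by \<open>inj_on_fst_jumps\<close>, while \<open>lookdown_graph_simultaneous\<close>
  shows that some lookdown graphs do not.\<close>

theorem proposition2p9:
  shows "bij_betw jumps flows {p \<in> lookdown_graphs. inj_on fst p}"
  unfolding bij_betw_def
proof (intro conjI inj_on_jumps equalityI subsetI)
  fix p assume "p \<in> jumps ` flows"
  then obtain a J where "growth_flow a J" "p = jumps (fibre_flow a)"
    using flows_eq_fibre_flow by (metis imageE)
  then show "p \<in> {p \<in> lookdown_graphs. inj_on fst p}"
    using growth_flow.jumps_in_lookdown_graphs inj_on_fst_jumps by blast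
qed (use lookdown_graph_eq_jumps in blast)

end
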